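(* Let $\mathbf{M}$ be a Markov process with state space $(S,\mathcal{S})$ and transition function $p^{t}(x,dy)$, $t\in\mathbb{T}$, $x\in S$. Assume that there is $\pi\in\mathcal{P}(S)$ satisfying $$\lim_{t\to\infty}\ \sup_{s\in\mathbb{T}}\int_S d_W\big(p^{t}(y,dz),\pi(dz)\big)\,p^{s}(x,dy)=0\qquad\text{for every } x\in S.$$ Then: (i) for every $f\in Lip(S)$ and $\mu\in\mathcal{P}(S)$, $\frac{1}{t}\int_{[0,t)}f(M_s)\,\tau(ds)\to\int_S f(y)\,\pi(dy)$ in probability with respect to $\mathbb{P}^\mu$ as $t\nearrow\infty$, $t\in\mathbb{T}$; (ii) for every $f\in Lip(S)$, $\mu\in\mathcal{P}(S)$ and every sequence $\{t_n\}_{n\in\mathbb{N}}\subseteq\mathbb{T}$ with $t_n\nearrow\infty$, there is a subsequence $\{t_{n_k}\}_{k\in\mathbb{N}}\subseteq\{t_n\}_{n\in\mathbb{N}}$ (possibly depending on $f$ and $\mu$) such that $$\lim_{k\to\infty}\frac{1}{t_{n_k}}\int_{[0,t_{n_k})}f(M_s)\,\tau(ds)=\int_S f(y)\,\pi(dy)\qquad \mathbb{P}^\mu\text{-a.s.};$$ (iii) $p^t(x,dy)$, $t\in\mathbb{T}$, is weak-$*$ mean ergodic, that is, for every $\mu\in\mathcal{P}(S)$ the probability measures $$\frac{1}{t}\int_{[0,t)}\int_S p^{s}(x,dy)\,\mu(dx)\,\tau(ds)$$ converge weakly to $\pi(dy)$ as $t\nearrow\infty$, $t\in\mathbb{T}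$.
   Context: State space: $(S,d)$ is a non-empty Polish space, i.e. $d$ is a complete and separable metric on $S$, $\mathcal{S}$ is its Borel $\sigma$-algebra, and $d$ is bounded by $1$: $\sup_{x,y\in S}d(x,y)\le 1$. The time set $\mathbb{T}$ is either $\{0,1,2,\ldots\}$ or $[0,\infty)$, and $\tau$ is the counting measure on $\mathbb{T}$ in the first case and Lebesgue measure in the second. Process: $\mathbf{M}=(\Omega,\mathcal{F},\{\mathbb{P}^{x}\}_{x\in S},\{\mathcal{F}_t\}_{t\in\mathbb{T}},\{\theta_t\}_{t\in\mathbb{T}},\{M_t\}_{t\in\mathbb{T}})$ is a temporally homogeneous normal Markov process with state space $(S,\mathcal{S})$: each $(\Omega,\mathcal{F},\mathbb{P}^x)$ is a probability space; $\{\mathcal{F}_t\}$ is a filtration; $M_t:\Omega\to S$ is $\mathcal{F}_t/\mathcal{S}$-measurable; $\mathbb{P}^x(M_0=x)=1$ (normality); $x\mapsto\mathbb{P}^x(B)$ is $\mathcal{S}$-measurable for $B\in\mathcal{F}$; the shift operators $\theta_t:\Omega\to\Omega$ satisfy $M_t\circ\theta_s=M_{t+s}$; and the Markov property $\mathbb{P}^x(M_{t+s}\in B\mid\mathcal{F}_t)=p^s(M_t,B)$ $\mathbb{P}^x$-a.s. holds for all $s,t\in\mathbb{T}$, $x\in S$, $B\in\mathcal{S}$, where $p^{t}(x,dy):=\mathbb{P}^{x}(M_t\in dy)$ is the transition function. If $\mathbb{T}=[0,\infty)$, $\mathbf{M}$ is assumed progressively measurable: for each $t\ge0$ the map $(s,\omega)\mapsto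 M_s(\omega)$ from $[0,t]\times\Omega$ to $S$ is $\mathcal{B}([0,t])\times\mathcal{F}_t/\mathcal{S}$-measurable. $\mathcal{P}(S)$ is the set of probability measures on $\mathcal{S}$; for $\mu\in\mathcal{P}(S)$, $\mathbb{P}^\mu(d\omega):=\int_S\mathbb{P}^y(d\omega)\,\mu(dy)$. $Lip(S)$ is the space of all $f:S\to\mathbb{R}$ for which there is $L_f\ge0$ with $|f(x)-f(y)|\le L_f\,d(x,y)$ for all $x,y\in S$; the best constant is denoted $|f|_{Lip}$. Since $d\le1$, every $f\in Lip(S)$ is bounded. The $L^1$-Wasserstein metric on $\mathcal{P}(S)$ is $$d_W(\mu,\nu):=\sup_{f\in Lip(S),\,|f|_{Lip}\le1}\left|\int_S f\,d\mu-\int_S f\,d\nu\right|.$$ The function $x\mapsto d_W(p^t(x,dy),\pi(dy))$ is $\mathcal{S}$-measurable for each $t\in\mathbb{T}$. Weak convergence means convergence of integrals of all bounded continuous real functions on $S$. *)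

theory Defs
  imports "HOL-Probability.Probability"
begin

text \<open>
  The time set is a subset of the reals, either \<open>\<nat>\<close> or \<open>{0..}\<close>, so that both cases are covered by
  one statement.  Functions of time are total on the reals, but only their values on \<open>T\<close> matter.
\<close>

definition time_set :: "real set \<Rightarrow> bool" where
  "time_set T \<longleftrightarrow> T = \<nat> \<or> T = {0..}"

definition time_measure :: "real set \<Rightarrow> real measure" where
  "time_measure T = (if T = \<nat> then count_space \<nat> else restrict_space lborel T)"

definition time_at_top :: "real set \<Rightarrow> real filter" where
  "time_at_top T = inf at_top (principal T)"

definition Lip :: "('a::metric_space \<Rightarrow> real) set" where
  "Lip = {f. \<exists>L. lipschitz_on L UNIV f}"

definition Lip_norm :: "('a::metric_space \<Rightarrow> real) \<Rightarrow> real" where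
  "Lip_norm f = Inf {L. lipschitz_on L UNIV f}"

definition prob_measures :: "'a::topological_space measure set" where
  "prob_measures = {\<mu>. prob_space \<mu> \<and> sets \<mu> = sets borel}"

text \<open>
  The supremum is taken in the reals; it is finite when the metric is bounded and both arguments are
  probability measures.
\<close>

definition wasserstein :: "'a::metric_space measure \<Rightarrow> 'a measure \<Rightarrow> real" where
  "wasserstein \<mu> \<nu> = (SUP f\<in>{f \<in> Lip. Lip_norm f \<le> 1}. \<bar>(\<integral>x. f x \<partial>\<mu>) - (\<integral>x. f x \<partial>\<nu>)\<bar>)"

definition transition ::
  "('a::topological_space \<Rightarrow> 'w measure) \<Rightarrow> (real \<Rightarrow> 'w \<Rightarrow> 'a) \<Rightarrow> real \<Rightarrow> 'a \<Rightarrow> 'a measure" where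
  "transition P M t x = distr (P x) borel (M t)"

text \<open>
  The measurable space of the process is \<open>\<F>\<close>; the measure that \<open>\<F>\<close> carries as an element of the type
  \<open>measure\<close> is irrelevant, and likewise for \<open>Ft t\<close>.  That \<open>P\<close> is a measurable map into
  \<open>prob_algebra \<F>\<close> says that every \<open>P x\<close> is a probability measure on \<open>\<F>\<close> and that \<open>x \<mapsto> P x (B)\<close> is
  measurable for all \<open>B\<close> in \<open>\<F>\<close>.
\<close>

locale markov_process =
  fixes T :: "real set"
    and \<F> :: "'w measure"
    and P :: "'a::polish_space \<Rightarrow> 'w measure"
    and Ft :: "real \<Rightarrow> 'w measure"
    and \<theta> :: "real \<Rightarrow> 'w \<Rightarrow> 'w"
    and M :: "real \<Rightarrow> 'w \<Rightarrow> 'a"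
  assumes time_set: "time_set T"
    and kernel: "P \<in> borel \<rightarrow>\<^sub>M prob_algebra \<F>"
    and filtration: "\<And>t. t \<in> T \<Longrightarrow> subalgebra \<F> (Ft t)"
    and filtration_mono: "\<And>s t. s \<in> T \<Longrightarrow> t \<in> T \<Longrightarrow> s \<le> t \<Longrightarrow> sets (Ft s) \<subseteq> sets (Ft t)"
    and adapted: "\<And>t. t \<in> T \<Longrightarrow> M t \<in> Ft t \<rightarrow>\<^sub>M borel"
    and progressive: "\<And>t. T = {0..} \<Longrightarrow> 0 \<le> t \<Longrightarrow>
      (\<lambda>(s, \<omega>). M s \<omega>) \<in> restrict_space borel {0..t} \<Otimes>\<^sub>M Ft t \<rightarrow>\<^sub>M borel"
    and normal: "\<And>x. measure (P x) {\<omega> \<in> space \<F>. M 0 \<omega> = x} = 1"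
    and shift_space: "\<And>t. t \<in> T \<Longrightarrow> \<theta> t \<in> space \<F> \<rightarrow> space \<F>"
    and shift: "\<And>s t \<omega>. s \<in> T \<Longrightarrow> t \<in> T \<Longrightarrow> \<omega> \<in> space \<F> \<Longrightarrow> M t (\<theta> s \<omega>) = M (t + s) \<omega>"
    and markov: "\<And>s t x B. s \<in> T \<Longrightarrow> t \<in> T \<Longrightarrow> B \<in> sets borel \<Longrightarrow>
      AE \<omega> in P x. real_cond_exp (P x) (Ft t) (\<lambda>\<omega>. indicator B (M (t + s) \<omega>)) \<omega>
                 = measure (transition P M s (M t \<omega>)) B"

definition time_average ::
  "real set \<Rightarrow> (real \<Rightarrow> 'w \<Rightarrow> 'a) \<Rightarrow> ('a \<Rightarrow> real) \<Rightarrow> real \<Rightarrow> 'w \<Rightarrow> real" where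
  "time_average T M f t \<omega> = (1 / t) * (LINT s:{0..<t}|time_measure T. f (M s \<omega>))"

text \<open>
  By \<open>emeasure_bind\<close>, for \<open>t > 0\<close> this is the measure that sends a Borel set \<open>B\<close> to
  \<open>1/t\<close> times the integral over \<open>s\<close> in \<open>[0,t)\<close> and \<open>x\<close> of \<open>p\<^sup>s(x,B)\<close> with respect to
  \<open>\<mu>(dx)\<close> and \<open>\<tau>(ds)\<close>.
\<close>

definition mean_measure ::
  "real set \<Rightarrow> ('a::topological_space \<Rightarrow> 'w measure) \<Rightarrow> (real \<Rightarrow> 'w \<Rightarrow> 'a) \<Rightarrow> 'a measure \<Rightarrow> real \<Rightarrow> 'a measure"
  where
  "mean_measure T P M \<mu> t = scale_measure (ennreal (1 / t))
     (restrict_space (time_measure T) {0..<t} \<bind> (\<lambda>s. \<mu> \<bind> transition P M s))"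

definition tendsto_in_prob ::
  "'w measure \<Rightarrow> ('t \<Rightarrow> 'w \<Rightarrow> real) \<Rightarrow> real \<Rightarrow> 't filter \<Rightarrow> bool" where
  "tendsto_in_prob Q X c F \<longleftrightarrow>
     (\<forall>\<^sub>F t in F. X t \<in> borel_measurable Q) \<and>
     (\<forall>\<epsilon>>0. ((\<lambda>t. measure Q {\<omega> \<in> space Q. \<bar>X t \<omega> - c\<bar> > \<epsilon>}) \<longlongrightarrow> 0) F)"

definition tendsto_weakly ::
  "('t \<Rightarrow> 'a::topological_space measure) \<Rightarrow> 'a measure \<Rightarrow> 't filter \<Rightarrow> bool" where
  "tendsto_weakly N \<nu> F \<longleftrightarrow>
     (\<forall>\<^sub>F t in F. N t \<in> prob_measures) \<and> \<nu> \<in> prob_measures \<and>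
     (\<forall>g :: 'a \<Rightarrow> real. continuous_on UNIV g \<longrightarrow> bounded (range g) \<longrightarrow>
        ((\<lambda>t. \<integral>x. g x \<partial>N t) \<longlongrightarrow> (\<integral>x. g x \<partial>\<nu>)) F)"

end

theory Submission
  imports Defs
begin

text \<open>
  Let \<open>f\<close> be \<open>L\<close>-Lipschitz and \<open>g = f - \<integral>f d\<pi>\<close>, so \<open>\<bar>g\<bar> \<le> L\<close>.  For \<open>s \<le> u\<close>, conditioning on \<open>\<F>\<^sub>s\<close>
  turns \<open>g(M\<^sub>u)\<close> into \<open>p\<^bsup>u-s\<^esup>g(M\<^sub>s)\<close>, which is at most \<open>L d\<^sub>W(p\<^bsup>u-s\<^esup>(M\<^sub>s), \<pi>)\<close> in absolute value; hence under \<open>P\<^sup>x\<close>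
  the correlation of \<open>g(M\<^sub>s)\<close> and \<open>g(M\<^sub>u)\<close> is at most a constant times the supremum in the hypothesis at lag
  \<open>u - s\<close>.  Integrating over the square \<open>[0,t)\<^sup>2\<close>, where lags below a fixed bound only fill a strip of
  area \<open>O(t)\<close>, shows that the time average of \<open>g\<close> tends to \<open>0\<close> in \<open>L\<^sup>2(P\<^sup>x)\<close> for every \<open>x\<close>, and by
  dominated convergence in \<open>L\<^sup>2(P\<^sup>\<mu>)\<close>.  Chebyshev's inequality gives (i), (ii) is the usual subsequence
  of an \<open>L\<^sup>1\<close>-null sequence, and (iii) follows by taking expectations, since Lipschitz functions
  suffice to test weak convergence.
\<close>

section \<open>Lipschitz functions and the Wasserstein distance\<close>

text \<open>The infimum in \<open>Lip_norm\<close> is attained: every admissible constant bounds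
  each difference quotient, hence so does their greatest lower bound.\<close>

lemma lipschitz_on_Lip_norm:
  assumes "f \<in> Lip" shows "(Lip_norm f)-lipschitz_on UNIV f"
proof (rule lipschitz_onI)
  obtain K where K: "K-lipschitz_on UNIV f" using assms by (auto simp: Lip_def)
  show "0 \<le> Lip_norm f" unfolding Lip_norm_def
    by (rule cInf_greatest) (use K in \<open>auto intro: lipschitz_on_nonneg\<close>)
  fix x y :: 'a
  show "dist (f x) (f y) \<le> Lip_norm f * dist x y"
  proof (cases "x = y")
    case False
    have "dist (f x) (f y) / dist x y \<le> Lip_norm f" unfolding Lip_norm_def
    proof (rule cInf_greatest)
      fix L assume "L \<in> {L. L-lipschitz_on UNIV f}"
      then have "dist (f x) (f y) \<le> L * dist x y" by (auto dest: lipschitz_onD)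
      then show "dist (f x) (f y) / dist x y \<le> L" using False by (simp add: divide_simps)
    qed (use K in auto)
    then show ?thesis using False by (simp add: divide_simps)
  qed simp
qed

text \<open>Lets the supremum in \<open>wasserstein\<close> be tested with 1-Lipschitz functions
  directly, without the infimum in \<open>Lip_norm\<close>.\<close>

lemma Lip_unit_ball: "{f \<in> Lip. Lip_norm f \<le> 1} = {f. 1-lipschitz_on UNIV f}"
proof (intro equalityI subsetI CollectI conjI; elim CollectE conjE)
  fix f :: "'a \<Rightarrow> real" assume "f \<in> Lip" "Lip_norm f \<le> 1"
  then show "1-lipschitz_on UNIV f" using lipschitz_on_Lip_norm lipschitz_on_mono by blast
next
  fix f :: "'a \<Rightarrow> real" assume *: "1-lipschitz_on UNIV f"
  show "f \<in> Lip" using * by (auto simp: Lip_def)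
  show "Lip_norm f \<le> 1" unfolding Lip_norm_def
    by (rule cInf_lower) (use * in \<open>auto simp: bdd_below_def intro!: exI[of _ 0] lipschitz_on_nonneg\<close>)
qed

lemma prob_measuresD:
  assumes "\<mu> \<in> prob_measures"
  shows "prob_space \<mu>" "sets \<mu> = sets borel" "space \<mu> = UNIV"
  using assms sets_eq_imp_space_eq[of \<mu> borel] by (auto simp: prob_measures_def)

lemma prob_measures_prob_algebra: "prob_measures = space (prob_algebra borel)"
  by (auto simp: prob_measures_def space_prob_algebra)

lemma lipschitz_borel_measurable:
  fixes f :: "'a::metric_space \<Rightarrow> real"
  assumes "L-lipschitz_on UNIV f" shows "f \<in> borel_measurable borel"
  using assms lipschitz_on_continuous_on borel_measurable_continuous_onI by blast

lemma integrable_bounded_prob_measures: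
  fixes f :: "'a::metric_space \<Rightarrow> real"
  assumes "\<mu> \<in> prob_measures" "f \<in> borel_measurable borel" "\<And>x. \<bar>f x\<bar> \<le> B"
  shows "integrable \<mu> f"
proof -
  interpret prob_space \<mu> using assms prob_measuresD by blast
  show ?thesis using assms prob_measuresD[OF assms(1)]
    by (intro integrable_const_bound[of _ B]) (auto simp: measurable_cong_sets[of \<mu> borel])
qed

context
  assumes dist_le_1: "\<And>x y :: 'a::{metric_space, second_countable_topology}. dist x y \<le> 1"
begin

lemma lipschitz_osc_le:
  fixes f :: "'a \<Rightarrow> real"
  assumes "L-lipschitz_on UNIV f" shows "\<bar>f x - f y\<bar> \<le> L"
proof -
  have "\<bar>f x - f y\<bar> \<le> L * dist x y" using lipschitz_onD[OF assms, of x y] by (simp add: dist_real_def)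
  also have "\<dots> \<le> L * 1" using lipschitz_on_nonneg[OF assms] dist_le_1 by (intro mult_left_mono)
  finally show ?thesis by simp
qed

lemma lipschitz_bounded:
  fixes f :: "'a \<Rightarrow> real"
  assumes "L-lipschitz_on UNIV f" shows "\<bar>f x\<bar> \<le> \<bar>f y\<bar> + L"
  using lipschitz_osc_le[OF assms, of x y] by linarith

lemma lipschitz_integrable:
  fixes f :: "'a \<Rightarrow> real"
  assumes "L-lipschitz_on UNIV f" "\<mu> \<in> prob_measures" shows "integrable \<mu> f"
  using integrable_bounded_prob_measures[OF assms(2) lipschitz_borel_measurable[OF assms(1)]]
    lipschitz_bounded[OF assms(1)] by blast

text \<open>The difference is the \<open>\<mu>\<close>-average of \<open>f x - f y\<close> over
  \<open>y\<close>, and each of these is at most \<open>L\<close> because distances are at most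
  1.\<close>

lemma lipschitz_centered_bound:
  fixes f :: "'a \<Rightarrow> real"
  assumes f: "L-lipschitz_on UNIV f" and \<mu>: "\<mu> \<in> prob_measures"
  shows "\<bar>f x - (\<integral>y. f y \<partial>\<mu>)\<bar> \<le> L"
proof -
  interpret prob_space \<mu> using \<mu> prob_measuresD by blast
  have "f x - (\<integral>y. f y \<partial>\<mu>) = (\<integral>y. f x - f y \<partial>\<mu>)"
    using lipschitz_integrable[OF f \<mu>] by (simp add: prob_space)
  also have "\<bar>\<dots>\<bar> \<le> (\<integral>y. L \<partial>\<mu>)"
    using lipschitz_integrable[OF f \<mu>] lipschitz_osc_le[OF f]
    by (intro order_trans[OF integral_abs_bound] integral_mono) auto
  finally show ?thesis by (simp add: prob_space)
qed

lemma lipschitz_integral_diff_bound: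
  fixes f :: "'a \<Rightarrow> real"
  assumes f: "L-lipschitz_on UNIV f" and \<mu>: "\<mu> \<in> prob_measures" and \<nu>: "\<nu> \<in> prob_measures"
  shows "\<bar>(\<integral>x. f x \<partial>\<mu>) - (\<integral>x. f x \<partial>\<nu>)\<bar> \<le> L"
proof -
  interpret prob_space \<mu> using \<mu> prob_measuresD by blast
  have "(\<integral>x. f x \<partial>\<mu>) - (\<integral>x. f x \<partial>\<nu>) = (\<integral>x. f x - (\<integral>y. f y \<partial>\<nu>) \<partial>\<mu>)"
    using lipschitz_integrable[OF f \<mu>] by (simp add: prob_space)
  also have "\<bar>\<dots>\<bar> \<le> (\<integral>y. L \<partial>\<mu>)"
    using lipschitz_integrable[OF f \<mu>] lipschitz_centered_bound[OF f \<nu>]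
    by (intro order_trans[OF integral_abs_bound] integral_mono) auto
  finally show ?thesis by (simp add: prob_space)
qed

section \<open>Estimates for the Wasserstein supremum\<close>

lemma wasserstein_bdd_above:
  assumes "\<mu> \<in> prob_measures" "\<nu> \<in> prob_measures" "C \<subseteq> {f :: 'a \<Rightarrow> real. 1-lipschitz_on UNIV f}"
  shows "bdd_above ((\<lambda>f. \<bar>(\<integral>x. f x \<partial>\<mu>) - (\<integral>x. f x \<partial>\<nu>)\<bar>) ` C)"
  using assms lipschitz_integral_diff_bound[of 1 _ \<mu> \<nu>] by (intro bdd_aboveI2[of _ _ 1]) auto

text \<open>\<open>f / L\<close> is 1-Lipschitz, so it competes in the supremum; boundedness above
  makes the real-valued supremum an actual upper bound.\<close>

lemma lipschitz_integral_le_wasserstein: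
  fixes f :: "'a \<Rightarrow> real"
  assumes f: "L-lipschitz_on UNIV f" and L: "L > 0"
    and \<mu>: "\<mu> \<in> prob_measures" and \<nu>: "\<nu> \<in> prob_measures"
  shows "\<bar>(\<integral>x. f x \<partial>\<mu>) - (\<integral>x. f x \<partial>\<nu>)\<bar> \<le> L * wasserstein \<mu> \<nu>"
proof -
  have 1: "1-lipschitz_on UNIV (\<lambda>x. f x / L)"
  proof (rule lipschitz_onI)
    fix x y
    have "dist (f x) (f y) \<le> L * dist x y" using f by (auto dest: lipschitz_onD)
    then show "dist (f x / L) (f y / L) \<le> 1 * dist x y"
      using L by (simp add: dist_real_def flip: diff_divide_distrib) (simp add: field_simps)
  qed simp
  have "\<bar>(\<integral>x. f x / L \<partial>\<mu>) - (\<integral>x. f x / L \<partial>\<nu>)\<bar> \<le> wasserstein \<mu> \<nu>"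
    unfolding wasserstein_def Lip_unit_ball
    by (rule cSUP_upper[OF _ wasserstein_bdd_above[OF \<mu> \<nu>], where x="\<lambda>x. f x / L"]) (use 1 in auto)
  then show ?thesis using L by (simp add: field_simps flip: diff_divide_distrib)
qed

lemma wasserstein_bounds:
  assumes \<mu>: "\<mu> \<in> prob_measures" and \<nu>: "(\<nu> :: 'a measure) \<in> prob_measures"
  shows "0 \<le> wasserstein \<mu> \<nu>" "wasserstein \<mu> \<nu> \<le> 1"
proof -
  \<comment> \<open>The zero function gives the lower bound and also shows that the supremum ranges
    over a non-empty set.\<close>
  have *: "1-lipschitz_on UNIV (\<lambda>x::'a. 0::real)" by (auto intro: lipschitz_onI)
  from lipschitz_integral_le_wasserstein[OF * _ \<mu> \<nu>] show "0 \<le> wasserstein \<mu> \<nu>" by simp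
  show "wasserstein \<mu> \<nu> \<le> 1" unfolding wasserstein_def Lip_unit_ball
    by (rule cSUP_least) (use * lipschitz_integral_diff_bound[OF _ \<mu> \<nu>] in auto)
qed

text \<open>
  Restricting \<open>1\<close>-Lipschitz functions to a countable dense set embeds them in the separable metric
  space of real sequences.
\<close>

lemma countable_lipschitz_dense:
  obtains C where "countable C" "C \<subseteq> {f :: 'a \<Rightarrow> real. 1-lipschitz_on UNIV f}" "C \<noteq> {}"
    "\<And>f. 1-lipschitz_on UNIV f \<Longrightarrow> \<exists>h. range h \<subseteq> C \<and> (\<forall>x. (\<lambda>n::nat. h n x) \<longlonglongrightarrow> f x)"
proof -
  obtain D :: "'a set" where D: "countable D" "\<And>X. open X \<Longrightarrow> X \<noteq> {} \<Longrightarrow> \<exists>d\<in>D. d \<in> X"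
    by (rule countable_dense_setE) blast
  have D0: "D \<noteq> {}" using D(2)[of UNIV] by auto
  define d where "d = from_nat_into D"
  have d: "range d = D" unfolding d_def by (rule range_from_nat_into[OF D0 D(1)])
  define U where "U = {f :: 'a \<Rightarrow> real. 1-lipschitz_on UNIV f}"
  have "(\<lambda>x::'a. 0::real) \<in> U" by (auto simp: U_def intro: lipschitz_onI)
  then have U0: "U \<noteq> {}" by auto
  \<comment> \<open>Any subset of the separable space of real sequences contains a countable set
    dense in it; \<open>C\<close> is a countable family of functions with these
    restrictions.\<close>
  obtain S where S: "countable S" "S \<subseteq> (\<lambda>f. f \<circ> d) ` U" "(\<lambda>f. f \<circ> d) ` U \<subseteq> closure S"
    using separable[of "(\<lambda>f. f \<circ> d) ` U"] by metis
  obtain C where C: "countable C" "C \<subseteq> U" "S = (\<lambda>f. f \<circ> d) ` C"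
    using S(1,2) countable_subset_image[of S "\<lambda>f. f \<circ> d" U] by metis
  show thesis
  proof (rule that[OF C(1)])
    show "C \<subseteq> {f. 1-lipschitz_on UNIV f}" using C by (simp add: U_def)
    show "C \<noteq> {}" using S C U0 by auto
    fix f :: "'a \<Rightarrow> real" assume f: "1-lipschitz_on UNIV f"
    then have "f \<circ> d \<in> closure S" using S(3) by (auto simp: U_def)
    then obtain v where v: "\<And>n. v n \<in> S" "v \<longlonglongrightarrow> (f \<circ> d)" unfolding closure_sequential by blast
    have "\<forall>n. \<exists>h\<in>C. v n = h \<circ> d" using v(1) C(3) by auto
    then obtain h where h: "\<And>n. h n \<in> C" "\<And>n. v n = h n \<circ> d" by metis
    have hl: "1-lipschitz_on UNIV (h n)" for n using h(1) C by (auto simp: U_def)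
    have lim_d: "(\<lambda>n. h n (d k)) \<longlonglongrightarrow> f (d k)" for k
    proof -
      have "continuous_on UNIV (\<lambda>g :: nat \<Rightarrow> real. g k)" by (rule continuous_on_product_coordinates)
      from continuous_on_tendsto_compose[OF this v(2)]
      have "(\<lambda>n. v n k) \<longlonglongrightarrow> (f \<circ> d) k" by simp
      then show ?thesis by (simp add: h)
    qed
    \<comment> \<open>Convergence on the dense set spreads to all points: moving from
      \<open>x\<close> to a nearby \<open>d k\<close> changes \<open>h n\<close> and
      \<open>f\<close> by less than \<open>e/3\<close> each, uniformly in \<open>n\<close>.\<close>
    have "(\<lambda>n. h n x) \<longlonglongrightarrow> f x" for x
    proof (rule LIMSEQ_I)
      fix e :: real assume e: "e > 0"
      obtain y where "y \<in> D" "y \<in> ball x (e/3)" using D(2)[of "ball x (e/3)"] e by auto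
      then obtain k where k: "dist x (d k) < e/3" using d by auto
      obtain N where N: "\<And>n. n \<ge> N \<Longrightarrow> \<bar>h n (d k) - f (d k)\<bar> < e/3"
        using LIMSEQ_D[OF lim_d[of k], of "e/3"] e by auto
      show "\<exists>N. \<forall>n\<ge>N. norm (h n x - f x) < e"
      proof (intro exI allI impI)
        fix n assume "n \<ge> N"
        have "\<bar>h n x - h n (d k)\<bar> < e/3" "\<bar>f x - f (d k)\<bar> < e/3"
          using lipschitz_onD[OF hl, of x "d k" n] lipschitz_onD[OF f, of x "d k"] k
          by (auto simp: dist_real_def)
        then show "norm (h n x - f x) < e" using N[OF \<open>n \<ge> N\<close>] unfolding real_norm_def by linarith
      qed
    qed
    then show "\<exists>h. range h \<subseteq> C \<and> (\<forall>x. (\<lambda>n::nat. h n x) \<longlonglongrightarrow> f x)"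
      using h(1) by (intro exI[of _ h]) blast
  qed
qed

text \<open>Convergence at one point bounds the values there, and the common oscillation bound
  \<open>L\<close> carries this to a uniform bound, so dominated convergence applies.\<close>

lemma lipschitz_integral_tendsto:
  fixes h :: "nat \<Rightarrow> 'a \<Rightarrow> real"
  assumes h: "\<And>n. L-lipschitz_on UNIV (h n)" and f: "L-lipschitz_on UNIV f"
    and lim: "\<And>x. (\<lambda>n. h n x) \<longlonglongrightarrow> f x" and \<mu>: "\<mu> \<in> prob_measures"
  shows "(\<lambda>n. \<integral>x. h n x \<partial>\<mu>) \<longlonglongrightarrow> (\<integral>x. f x \<partial>\<mu>)"
proof -
  interpret prob_space \<mu> using \<mu> prob_measuresD by blast
  define y :: 'a where "y = undefined"
  obtain K where K: "\<And>n. \<bar>h n y\<bar> \<le> K"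
    using convergent_imp_Bseq[OF convergentI[OF lim[of y]]] by (auto simp: Bseq_def)
  have "\<bar>h n x\<bar> \<le> K + L" for n x using lipschitz_bounded[OF h, of n x y] K[of n] by linarith
  then show ?thesis
    using borel_measurable_integrable[OF lipschitz_integrable[OF h \<mu>]]
      borel_measurable_integrable[OF lipschitz_integrable[OF f \<mu>]] lim
    by (intro integral_dominated_convergence[where w="\<lambda>_. K + L"]) auto
qed

text \<open>An uncountable supremum of measurable functions need not be measurable, so it is reduced
  to a countable family whose pointwise limits include every 1-Lipschitz function.\<close>

lemma wasserstein_measurable:
  assumes \<nu>: "(\<nu> :: 'a measure) \<in> prob_measures"
  shows "(\<lambda>\<mu>. wasserstein \<mu> \<nu>) \<in> borel_measurable (prob_algebra borel)"
proof -
  obtain C where C: "countable C" "C \<subseteq> {f :: 'a \<Rightarrow> real. 1-lipschitz_on UNIV f}" "C \<noteq> {}"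
    and dense: "\<And>f. 1-lipschitz_on UNIV f \<Longrightarrow> \<exists>h. range h \<subseteq> C \<and> (\<forall>x. (\<lambda>n::nat. h n x) \<longlonglongrightarrow> f x)"
    by (rule countable_lipschitz_dense) blast
  let ?F = "\<lambda>\<mu> f. \<bar>(\<integral>x. f x \<partial>\<mu>) - (\<integral>x. f x \<partial>\<nu>)\<bar>"
  have eq: "wasserstein \<mu> \<nu> = (SUP f\<in>C. ?F \<mu> f)" if \<mu>: "\<mu> \<in> prob_measures" for \<mu>
    unfolding wasserstein_def Lip_unit_ball
  proof (rule antisym)
    show "(SUP f\<in>C. ?F \<mu> f) \<le> (SUP f\<in>{f. 1-lipschitz_on UNIV f}. ?F \<mu> f)"
      by (rule cSUP_subset_mono[OF C(3) wasserstein_bdd_above[OF \<mu> \<nu>] C(2)]) auto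
    show "(SUP f\<in>{f. 1-lipschitz_on UNIV f}. ?F \<mu> f) \<le> (SUP f\<in>C. ?F \<mu> f)"
    proof (rule cSUP_least)
      show "{f :: 'a \<Rightarrow> real. 1-lipschitz_on UNIV f} \<noteq> {}" using C by auto
      fix f :: "'a \<Rightarrow> real" assume "f \<in> {f. 1-lipschitz_on UNIV f}"
      then have f: "1-lipschitz_on UNIV f" by simp
      then obtain h where h: "range h \<subseteq> C" "\<And>x. (\<lambda>n::nat. h n x) \<longlonglongrightarrow> f x" using dense by blast
      have hl: "1-lipschitz_on UNIV (h n)" for n using h(1) C by auto
      have "(\<lambda>n. ?F \<mu> (h n)) \<longlonglongrightarrow> ?F \<mu> f"
        by (intro tendsto_intros lipschitz_integral_tendsto[OF hl f h(2)] \<mu> \<nu>)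
      then show "?F \<mu> f \<le> (SUP f\<in>C. ?F \<mu> f)"
        by (rule LIMSEQ_le_const2)
           (use h(1) in \<open>auto intro!: exI[of _ 0] cSUP_upper wasserstein_bdd_above[OF \<mu> \<nu> C(2)]\<close>)
    qed
  qed
  have "(\<lambda>\<mu>. SUP f\<in>C. ?F \<mu> f) \<in> borel_measurable (prob_algebra borel)"
  proof (rule borel_measurable_cSUP[OF C(1)])
    fix f assume "f \<in> C"
    then have [measurable]: "f \<in> borel_measurable borel" using C lipschitz_borel_measurable by blast
    have "(\<lambda>\<mu>. \<integral>x. f x \<partial>\<mu>) \<in> borel_measurable (prob_algebra borel)"
      unfolding prob_algebra_def by (intro measurable_restrict_space1 integral_measurable_subprob_algebra) measurable
    then show "(\<lambda>\<mu>. ?F \<mu> f) \<in> borel_measurable (prob_algebra borel)" by measurable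
  next
    fix \<mu> :: "'a measure" assume "\<mu> \<in> space (prob_algebra borel)"
    then show "bdd_above (?F \<mu> ` C)"
      using wasserstein_bdd_above[OF _ \<nu> C(2)] by (simp add: prob_measures_prob_algebra)
  qed
  then show ?thesis
    by (subst measurable_cong[OF eq]) (auto simp: prob_measures_prob_algebra)
qed

end

text \<open>The square is a product of two integrals over \<open>N\<close>. Fubini moves first one
  and then the other outside the integral over \<open>Q\<close>; boundedness and finite measures
  give integrability each time.\<close>

lemma second_moment_Fubini:
  fixes G :: "'s \<Rightarrow> 'w \<Rightarrow> real"
  assumes N: "finite_measure N" and Q: "finite_measure Q"
    and G[measurable]: "(\<lambda>(s, \<omega>). G s \<omega>) \<in> borel_measurable (N \<Otimes>\<^sub>M Q)"
    and bound: "\<And>s \<omega>. \<bar>G s \<omega>\<bar> \<le> L"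
  shows "(\<integral>\<omega>. (\<integral>s. G s \<omega> \<partial>N)\<^sup>2 \<partial>Q) = (\<integral>u. \<integral>s. (\<integral>\<omega>. G u \<omega> * G s \<omega> \<partial>Q) \<partial>N \<partial>N)"
proof -
  interpret N: finite_measure N by fact
  interpret Q: finite_measure Q by fact
  interpret NQ: pair_sigma_finite N Q ..
  interpret P: finite_measure "N \<Otimes>\<^sub>M Q" by (rule finite_measure_pair_measure) fact+
  have swap[measurable]: "(\<lambda>(\<omega>, s). G s \<omega>) \<in> borel_measurable (Q \<Otimes>\<^sub>M N)"
    using measurable_compose[OF measurable_pair_swap' G] by (simp add: case_prod_unfold)
  have L: "0 \<le> L" using order_trans[OF abs_ge_zero bound] .
  define X where "X \<omega> = (\<integral>s. G s \<omega> \<partial>N)" for \<omega>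
  have X[measurable]: "X \<in> borel_measurable Q"
    unfolding X_def by (rule N.borel_measurable_lebesgue_integral) (rule swap)
  have XL: "\<bar>X \<omega>\<bar> \<le> L * measure N (space N)" for \<omega>
  proof -
    have "\<bar>X \<omega>\<bar> \<le> (\<integral>s. \<bar>G s \<omega>\<bar> \<partial>N)" unfolding X_def by (rule integral_abs_bound)
    \<comment> \<open>\<open>integral_mono_AE'\<close> asks for no integrability on the smaller
      side, which matters because \<open>\<omega>\<close> is arbitrary; it asks instead that
      \<open>L\<close> be nonnegative.\<close>
    also have "\<dots> \<le> (\<integral>s. L \<partial>N)" by (rule integral_mono_AE') (use bound L in auto)
    finally show ?thesis by (simp add: mult.commute)
  qed
  have "(\<integral>\<omega>. (X \<omega>)\<^sup>2 \<partial>Q) = (\<integral>\<omega>. \<integral>u. G u \<omega> * X \<omega> \<partial>N \<partial>Q)"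
    by (simp add: X_def power2_eq_square)
  also have "\<dots> = (\<integral>u. \<integral>\<omega>. G u \<omega> * X \<omega> \<partial>Q \<partial>N)"
  proof (rule NQ.Fubini_integral, rule P.integrable_const_bound)
    show "AE z in N \<Otimes>\<^sub>M Q. norm (case z of (u, \<omega>) \<Rightarrow> G u \<omega> * X \<omega>) \<le> L * (L * measure N (space N))"
      by (rule AE_I2) (use bound XL L in \<open>auto simp: abs_mult intro!: mult_mono\<close>)
  qed measurable
  also have "\<dots> = (\<integral>u. \<integral>s. (\<integral>\<omega>. G u \<omega> * G s \<omega> \<partial>Q) \<partial>N \<partial>N)"
  proof (rule Bochner_Integration.integral_cong[OF refl])
    fix u assume "u \<in> space N"
    then have [measurable]: "G u \<in> borel_measurable Q" using measurable_Pair2[OF G] by simp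
    have "(\<integral>\<omega>. G u \<omega> * X \<omega> \<partial>Q) = (\<integral>\<omega>. \<integral>s. G u \<omega> * G s \<omega> \<partial>N \<partial>Q)" by (simp add: X_def)
    also have "\<dots> = (\<integral>s. (\<integral>\<omega>. G u \<omega> * G s \<omega> \<partial>Q) \<partial>N)"
    proof (rule NQ.Fubini_integral, rule P.integrable_const_bound)
      show "AE z in N \<Otimes>\<^sub>M Q. norm (case z of (s, \<omega>) \<Rightarrow> G u \<omega> * G s \<omega>) \<le> L * L"
        by (rule AE_I2) (use bound L in \<open>auto simp: abs_mult intro!: mult_mono\<close>)
    qed measurable
    finally show "(\<integral>\<omega>. G u \<omega> * X \<omega> \<partial>Q) = (\<integral>s. (\<integral>\<omega>. G u \<omega> * G s \<omega> \<partial>Q) \<partial>N)" .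
  qed
  finally show ?thesis by (simp add: X_def)
qed

section \<open>Time windows\<close>

text \<open>Half-open, so that both time sets give total mass exactly \<open>t\<close> when
  \<open>t \<in> T\<close>.\<close>

definition time_window :: "real set \<Rightarrow> real \<Rightarrow> real measure" where
  "time_window T t = restrict_space (time_measure T) {0..<t}"

text \<open>\<open>time_measure\<close> decides by the test \<open>T = \<nat>\<close>, so continuous
  time must fail that test; 1/2 tells the two sets apart.\<close>

lemma nonneg_ne_Nats: "{0..} \<noteq> (\<nat> :: real set)"
proof
  assume "{0..} = (\<nat> :: real set)"
  moreover have "(1/2 :: real) \<in> {0..}" by simp
  ultimately have "(1/2 :: real) \<in> \<nat>" by simp
  then obtain n where "1/2 = real n" by (auto elim: Nats_cases)
  then have "1 = 2 * n" by linarith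
  then show False by presburger
qed

lemma time_window_Nats: "time_window \<nat> t = count_space (\<nat> \<inter> {0..<t})"
  by (simp add: time_window_def time_measure_def restrict_count_space Int_commute)

lemma time_window_nonneg: "time_window {0..} t = restrict_space lborel {0..<t}"
proof -
  have "{0..} \<inter> {0..<t} = {0..<t}" by auto
  then show ?thesis by (simp add: time_window_def time_measure_def restrict_restrict_space nonneg_ne_Nats)
qed

lemma Nats_before: "\<nat> \<inter> {0..<real n} = real ` {..<n}"
  by (auto elim!: Nats_cases)

lemma space_time_window: "time_set T \<Longrightarrow> space (time_window T t) = T \<inter> {0..<t}"
  by (auto simp: time_set_def time_window_Nats time_window_nonneg space_restrict_space)

lemma emeasure_time_window_space:
  assumes "time_set T" "t \<in> T" shows "emeasure (time_window T t) (space (time_window T t)) = t"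
  using assms(1) unfolding time_set_def
proof
  assume T: "T = \<nat>"
  then obtain n where n: "t = real n" using assms(2) by (auto elim: Nats_cases)
  show ?thesis unfolding T time_window_Nats n Nats_before
    by (simp add: card_image ennreal_of_nat_eq_real_of_nat)
next
  assume T: "T = {0..}"
  then show ?thesis using assms(2)
    by (simp add: time_window_nonneg space_restrict_space emeasure_restrict_space)
qed

lemma finite_measure_time_window:
  assumes "time_set T" "t \<in> T" shows "finite_measure (time_window T t)"
  by (rule finite_measureI) (simp add: emeasure_time_window_space assms)

lemma measure_time_window_space:
  assumes "time_set T" "t \<in> T" shows "measure (time_window T t) (space (time_window T t)) = t"
  using assms emeasure_time_window_space[OF assms] by (auto simp: measure_def time_set_def elim: Nats_cases)

lemma sets_time_window_interval:
  assumes "time_set T" shows "{s \<in> space (time_window T t). \<bar>s - u\<bar> \<le> R} \<in> sets (time_window T t)"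
  using assms unfolding time_set_def
proof
  assume T: "T = {0..}"
  have "{s \<in> space (time_window T t). \<bar>s - u\<bar> \<le> R} = {0..<t} \<inter> {u - R..u + R}"
    by (auto simp: T time_window_nonneg space_restrict_space)
  then show ?thesis by (simp add: T time_window_nonneg sets_restrict_space)
qed (auto simp: time_window_Nats)

text \<open>Bounds each slice of the strip of small lags. Discrete time allows 2k + 1 integers and
  continuous time a length of 2k, so one constant serves both.\<close>

lemma measure_time_window_interval:
  assumes "time_set T" "t \<in> T" "u \<in> T"
  shows "measure (time_window T t) {s \<in> space (time_window T t). \<bar>s - u\<bar> \<le> real k} \<le> 2 * real k + 1"
  using assms(1) unfolding time_set_def
proof
  assume T: "T = \<nat>"
  obtain n m where n: "t = real n" and m: "u = real m" using assms T by (auto elim!: Nats_cases)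
  have eq: "{s \<in> space (time_window T t). \<bar>s - u\<bar> \<le> real k} = real ` {i. i < n \<and> \<bar>int i - int m\<bar> \<le> int k}"
    unfolding T time_window_Nats n m Nats_before by auto
  have "measure (time_window T t) {s \<in> space (time_window T t). \<bar>s - u\<bar> \<le> real k}
      = card {i. i < n \<and> \<bar>int i - int m\<bar> \<le> int k}"
    unfolding eq unfolding T time_window_Nats n Nats_before
    by (subst measure_count_space) (auto simp: card_image)
  \<comment> \<open>Subtraction on \<open>nat\<close> truncates at 0, which only shortens the
    interval, so at most 2k + 1 points remain.\<close>
  also have "\<dots> \<le> card {m - k..m + k}" by (intro of_nat_mono card_mono) auto
  also have "\<dots> \<le> 2 * real k + 1" by simp
  finally show ?thesis .
next
  assume T: "T = {0..}"
  have eq: "{s \<in> space (time_window T t). \<bar>s - u\<bar> \<le> real k} = {0..<t} \<inter> {u - real k..u + real k}"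
    by (auto simp: T time_window_nonneg space_restrict_space)
  have "measure (time_window T t) ({0..<t} \<inter> {u - real k..u + real k})
      = measure lborel ({0..<t} \<inter> {u - real k..u + real k})"
    unfolding T time_window_nonneg by (rule measure_restrict_space) auto
  also have "\<dots> \<le> measure lborel {u - real k..u + real k}"
    by (rule measure_mono_fmeasurable) (auto simp: fmeasurable_def)
  finally show ?thesis unfolding eq by simp
qed

section \<open>The Markov property for integrals\<close>

context markov_process
begin

lemma T_diff: "s \<in> T \<Longrightarrow> u \<in> T \<Longrightarrow> s \<le> u \<Longrightarrow> u - s \<in> T"
  using time_set by (auto simp: time_set_def Nats_diff elim!: Nats_cases simp flip: of_nat_diff)

lemma T_zero: "0 \<in> T" using time_set by (auto simp: time_set_def)

lemma prob_space_P: "prob_space (P x)" and sets_P: "sets (P x) = sets \<F>" and space_P: "space (P x) = space \<F>"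
proof -
  have "P x \<in> space (prob_algebra \<F>)" using measurable_space[OF kernel] by simp
  then show "prob_space (P x)" "sets (P x) = sets \<F>" by (auto simp: space_prob_algebra)
  then show "space (P x) = space \<F>" by (auto dest: sets_eq_imp_space_eq)
qed

lemma measurable_M: "t \<in> T \<Longrightarrow> M t \<in> \<F> \<rightarrow>\<^sub>M borel"
  using filtration adapted measurable_from_subalg by blast

lemma subalgebra_P: "t \<in> T \<Longrightarrow> subalgebra (P x) (Ft t)"
  using filtration by (simp add: subalgebra_def sets_P space_P)

lemma measurable_transition: "t \<in> T \<Longrightarrow> transition P M t \<in> borel \<rightarrow>\<^sub>M prob_algebra borel"
  unfolding transition_def
  by (rule measurable_compose[OF kernel measurable_distr_prob_space]) (rule measurable_M)

lemma transition_prob_measures: "t \<in> T \<Longrightarrow> transition P M t x \<in> prob_measures"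
  using measurable_space[OF measurable_transition, of t x] by (simp add: prob_measures_prob_algebra)

text \<open>In discrete time the first factor is countable, and measurability of each
  \<open>M s\<close> suffices. In continuous time this is progressive measurability on
  \<open>{0..t}\<close>.\<close>

lemma jointly_measurable:
  assumes t: "t \<in> T" shows "(\<lambda>(s, \<omega>). M s \<omega>) \<in> time_window T t \<Otimes>\<^sub>M \<F> \<rightarrow>\<^sub>M borel"
  using time_set unfolding time_set_def
proof
  assume T: "T = \<nat>"
  show ?thesis unfolding T time_window_Nats
    by (rule measurable_pair_measure_countable1) (use T measurable_M in \<open>auto simp: Nats_def\<close>)
next
  assume T: "T = {0..}"
  \<comment> \<open>The identity, read as a map into the product space of the progressivity
    assumption: the window lies in \<open>{0..t}\<close>, and \<open>Ft t\<close> is a subalgebra of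
    \<open>\<F>\<close>.\<close>
  have 1: "(\<lambda>z. (fst z, snd z)) \<in> time_window T t \<Otimes>\<^sub>M \<F> \<rightarrow>\<^sub>M restrict_space borel {0..t} \<Otimes>\<^sub>M Ft t"
  proof (rule measurable_Pair)
    have "(\<lambda>s. s) \<in> time_window T t \<rightarrow>\<^sub>M restrict_space borel {0..t}"
      unfolding T time_window_nonneg
      by (rule measurable_restrict_space2)
         (auto intro!: measurable_restrict_space1 simp: space_restrict_space)
    then show "fst \<in> time_window T t \<Otimes>\<^sub>M \<F> \<rightarrow>\<^sub>M restrict_space borel {0..t}"
      by (rule measurable_compose[OF measurable_fst])
    have "(\<lambda>\<omega>. \<omega>) \<in> \<F> \<rightarrow>\<^sub>M Ft t"
      by (rule measurable_from_subalg[OF filtration[OF t] measurable_ident_sets[OF refl]])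
    then show "snd \<in> time_window T t \<Otimes>\<^sub>M \<F> \<rightarrow>\<^sub>M Ft t" by (rule measurable_compose[OF measurable_snd])
  qed
  show ?thesis using measurable_compose[OF 1 progressive[OF T, of t]] t T by (simp add: case_prod_unfold)
qed

text \<open>The Markov property is given for indicators only. Weighting \<open>P x\<close> by the
  nonnegative density \<open>h\<close> turns it into an identity of two measures, the law of
  \<open>M u\<close> and a mixture of transition kernels; integrating \<open>g\<close> against both
  extends it to bounded functions.\<close>

lemma markov_integral:
  fixes h :: "'w \<Rightarrow> real" and g :: "'a \<Rightarrow> real"
  assumes s: "s \<in> T" and u: "u \<in> T" "s \<le> u"
    and h: "h \<in> borel_measurable (Ft s)" "\<And>\<omega>. 0 \<le> h \<omega>" "\<And>\<omega>. h \<omega> \<le> 1"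
    and g[measurable]: "g \<in> borel_measurable borel" and gB: "\<And>y. \<bar>g y\<bar> \<le> B"
  shows "(\<integral>\<omega>. h \<omega> * g (M u \<omega>) \<partial>P x) = (\<integral>\<omega>. h \<omega> * (\<integral>y. g y \<partial>transition P M (u - s) (M s \<omega>)) \<partial>P x)"
proof -
  define r where "r = u - s"
  have r: "r \<in> T" "u = r + s" using T_diff[OF s u] by (auto simp: r_def)
  interpret P: prob_space "P x" by (rule prob_space_P)
  interpret S: finite_measure_subalgebra "P x" "Ft s"
    by unfold_locales (rule subalgebra_P[OF s])
  note [measurable_cong] = sets_P
  note [measurable] = measurable_M[OF s] measurable_M[OF u(1)]
  have hP[measurable]: "h \<in> borel_measurable (P x)"
    using measurable_from_subalg[OF subalgebra_P[OF s] h(1)] .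
  let ?K = "\<lambda>\<omega>. transition P M r (M s \<omega>)"
  have [measurable]: "M s \<in> P x \<rightarrow>\<^sub>M borel" by measurable
  have K: "?K \<in> P x \<rightarrow>\<^sub>M prob_algebra borel"
    by (rule measurable_compose[OF _ measurable_transition[OF r(1)]]) measurable
  note K'[measurable] = measurable_prob_algebraD[OF K]
  have K_prob: "?K \<omega> \<in> prob_measures" for \<omega> by (rule transition_prob_measures[OF r(1)])
  have Kmeas[measurable]: "B \<in> sets borel \<Longrightarrow> (\<lambda>\<omega>. measure (?K \<omega>) B) \<in> borel_measurable (P x)" for B
    by (rule measurable_compose[OF K' measurable_measure_subprob_algebra])
  define D where "D = density (P x) (\<lambda>\<omega>. ennreal (h \<omega>))"
  have space_D: "space D = space (P x)" and sets_D: "sets D = sets (P x)" by (auto simp: D_def)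
  have D_ne: "space D \<noteq> {}" using P.not_empty by (simp add: space_D)
  have KD: "?K \<in> D \<rightarrow>\<^sub>M subprob_algebra borel"
    using K' by (simp add: measurable_cong_sets[OF sets_D refl])
  have MD: "M u \<in> D \<rightarrow>\<^sub>M borel"
    using measurable_M[OF u(1)] by (simp add: measurable_cong_sets[OF sets_D refl] measurable_cong_sets[OF sets_P refl])
  have D_fin: "finite_measure D"
  proof (rule finite_measureI)
    have "emeasure D (space D) = (\<integral>\<^sup>+\<omega>. ennreal (h \<omega>) * indicator (space (P x)) \<omega> \<partial>P x)"
      unfolding D_def by (subst emeasure_density) auto
    also have "\<dots> \<le> (\<integral>\<^sup>+\<omega>. 1 \<partial>P x)"
      using h(3) by (intro nn_integral_mono) (auto split: split_indicator)
    finally show "emeasure D (space D) \<noteq> \<infinity>" by (auto simp: P.emeasure_space_1 top_unique)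
  qed
  \<comment> \<open>Checked on Borel sets: the weight \<open>h\<close> is
    \<open>Ft s\<close>-measurable, so the indicator may be replaced by its conditional expectation,
    which \<open>markov\<close> identifies with the kernel.\<close>
  have eq: "distr D borel (M u) = D \<bind> ?K"
  proof (rule measure_eqI)
    show "sets (distr D borel (M u)) = sets (D \<bind> ?K)"
      by (simp add: sets_bind_measurable[OF KD D_ne])
    fix A assume "A \<in> sets (distr D borel (M u))"
    then have A[measurable]: "A \<in> sets borel" by simp
    have "emeasure (distr D borel (M u)) A = (\<integral>\<^sup>+\<omega>. indicator A (M u \<omega>) \<partial>D)"
      using A MD by (simp add: emeasure_distr flip: nn_integral_indicator nn_integral_distr)
    also have "\<dots> = (\<integral>\<^sup>+\<omega>. ennreal (h \<omega>) * indicator A (M u \<omega>) \<partial>P x)"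
      unfolding D_def by (rule nn_integral_density) measurable
    also have "\<dots> = (\<integral>\<^sup>+\<omega>. ennreal (h \<omega> * indicator A (M u \<omega>)) \<partial>P x)"
      by (intro nn_integral_cong) (auto split: split_indicator)
    also have "\<dots> = ennreal (\<integral>\<omega>. h \<omega> * indicator A (M u \<omega>) \<partial>P x)"
      using h by (intro nn_integral_eq_integral P.integrable_const_bound[of _ 1])
        (auto split: split_indicator)
    also have "(\<integral>\<omega>. h \<omega> * indicator A (M u \<omega>) \<partial>P x)
        = (\<integral>\<omega>. h \<omega> * real_cond_exp (P x) (Ft s) (\<lambda>\<omega>. indicator A (M u \<omega>)) \<omega> \<partial>P x)"
      using h by (intro S.real_cond_exp_intg(2)[symmetric] P.integrable_const_bound[of _ 1])
        (auto split: split_indicator)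
    also have "\<dots> = (\<integral>\<omega>. h \<omega> * measure (?K \<omega>) A \<partial>P x)"
      using markov[OF r(1) s A, of x] by (intro integral_cong_AE) (auto simp: r(2) add.commute)
    also have "ennreal \<dots> = (\<integral>\<^sup>+\<omega>. ennreal (h \<omega> * measure (?K \<omega>) A) \<partial>P x)"
      using h prob_measuresD(1)[OF K_prob]
      by (intro nn_integral_eq_integral[symmetric] P.integrable_const_bound[of _ 1])
         (auto simp: abs_mult intro!: mult_le_one prob_space.prob_le_1)
    also have "\<dots> = (\<integral>\<^sup>+\<omega>. ennreal (h \<omega>) * emeasure (?K \<omega>) A \<partial>P x)"
      using h prob_measuresD(1)[OF K_prob]
      by (intro nn_integral_cong)
         (simp add: ennreal_mult finite_measure.emeasure_eq_measure[OF prob_space.finite_measure])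
    also have "\<dots> = (\<integral>\<^sup>+\<omega>. emeasure (?K \<omega>) A \<partial>D)"
      unfolding D_def by (rule nn_integral_density[symmetric]) measurable
    also have "\<dots> = emeasure (D \<bind> ?K) A"
      by (rule emeasure_bind[OF D_ne KD A, symmetric])
    finally show "emeasure (distr D borel (M u)) A = emeasure (D \<bind> ?K) A" .
  qed
  have "(\<integral>\<omega>. h \<omega> * g (M u \<omega>) \<partial>P x) = (\<integral>\<omega>. g (M u \<omega>) \<partial>D)"
    unfolding D_def using h by (subst integral_density) auto
  also have "\<dots> = (\<integral>y. g y \<partial>distr D borel (M u))" by (rule integral_distr[OF MD g, symmetric])
  also have "\<dots> = (\<integral>\<omega>. (\<integral>y. g y \<partial>?K \<omega>) \<partial>D)" unfolding eq
    by (rule integral_bind[OF g gB KD D_fin, where B'=1])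
       (use prob_space.emeasure_space_1[OF prob_measuresD(1)[OF K_prob]] in auto)
  also have "\<dots> = (\<integral>\<omega>. h \<omega> * (\<integral>y. g y \<partial>?K \<omega>) \<partial>P x)"
    unfolding D_def using h measurable_compose[OF K' integral_measurable_subprob_algebra[OF g]]
    by (subst integral_density) auto
  finally show ?thesis by (simp add: r_def)
qed

end

section \<open>Decay of correlations\<close>

lemma eventually_time_at_top:
  "eventually Q (time_at_top T) \<longleftrightarrow> eventually (\<lambda>t. t \<in> T \<longrightarrow> Q t) at_top"
  by (simp add: time_at_top_def eventually_inf_principal)

lemma eventually_time_at_topI:
  assumes "\<And>t. t \<in> T \<Longrightarrow> 0 < t \<Longrightarrow> Q t" shows "eventually Q (time_at_top T)"
  unfolding eventually_time_at_top using eventually_gt_at_top[of 0] by eventually_elim (use assms in auto)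

text \<open>Extension by 0 off \<open>T\<close> turns a limit along \<open>T\<close> into one along
  all reals, the form in which dominated convergence at \<open>at_top\<close> is applied.\<close>

lemma tendsto_time_at_top_iff:
  fixes f :: "real \<Rightarrow> real"
  shows "(f \<longlongrightarrow> 0) (time_at_top T) \<longleftrightarrow> ((\<lambda>t. if t \<in> T then f t else 0) \<longlongrightarrow> 0) at_top"
proof -
  have "(\<lambda>t. t \<in> T \<longrightarrow> dist (f t) 0 < e) = (\<lambda>t. dist (if t \<in> T then f t else 0) 0 < e)" if "e > 0" for e
    using that by auto
  then show ?thesis unfolding tendsto_iff eventually_time_at_top by (metis (lifting))
qed

locale ergodic_markov_process = markov_process T \<F> P Ft \<theta> M
  for T :: "real set" and \<F> :: "'w measure" and P :: "'a::polish_space \<Rightarrow> 'w measure"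
    and Ft :: "real \<Rightarrow> 'w measure" and \<theta> :: "real \<Rightarrow> 'w \<Rightarrow> 'w" and M :: "real \<Rightarrow> 'w \<Rightarrow> 'a" +
  fixes \<pi> :: "'a measure"
  assumes dist_le_1: "\<And>x y :: 'a. dist x y \<le> 1"
    and \<pi>: "\<pi> \<in> prob_measures"
    and ergodic: "\<And>x. ((\<lambda>t. SUP s\<in>T. \<integral>y. wasserstein (transition P M t y) \<pi> \<partial>transition P M s x)
                    \<longlongrightarrow> 0) (time_at_top T)"
begin

text \<open>The quantity that the ergodicity hypothesis sends to 0, as a function of the lag
  \<open>t\<close> for a fixed starting point.\<close>

definition mixing_rate :: "'a \<Rightarrow> real \<Rightarrow> real" where
  "mixing_rate x t = (SUP s\<in>T. \<integral>y. wasserstein (transition P M t y) \<pi> \<partial>transition P M s x)"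

lemma wasserstein_transition:
  assumes "t \<in> T"
  shows "(\<lambda>y. wasserstein (transition P M t y) \<pi>) \<in> borel_measurable borel"
    "0 \<le> wasserstein (transition P M t y) \<pi>" "wasserstein (transition P M t y) \<pi> \<le> 1"
  using measurable_compose[OF measurable_transition[OF assms] wasserstein_measurable[OF dist_le_1 \<pi>]]
    wasserstein_bounds[OF dist_le_1 transition_prob_measures[OF assms] \<pi>] by auto

lemma integral_wasserstein_bounds:
  assumes "t \<in> T" "s \<in> T"
  shows "0 \<le> (\<integral>y. wasserstein (transition P M t y) \<pi> \<partial>transition P M s x)"
    "(\<integral>y. wasserstein (transition P M t y) \<pi> \<partial>transition P M s x) \<le> 1"
proof -
  interpret prob_space "transition P M s x"
    using transition_prob_measures[OF assms(2)] prob_measuresD by blast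
  show "0 \<le> (\<integral>y. wasserstein (transition P M t y) \<pi> \<partial>transition P M s x)"
    using wasserstein_transition[OF assms(1)] by simp
  have "integrable (transition P M s x) (\<lambda>y. wasserstein (transition P M t y) \<pi>)"
    by (rule integrable_bounded_prob_measures[OF transition_prob_measures[OF assms(2)], of _ 1])
       (use wasserstein_transition[OF assms(1)] in auto)
  then show "(\<integral>y. wasserstein (transition P M t y) \<pi> \<partial>transition P M s x) \<le> 1"
    using wasserstein_transition(3)[OF assms(1)] by (intro integral_le_const) auto
qed

text \<open>By change of variables the left side is an integral against
  \<open>transition P M s x\<close>, one of the terms of the supremum.\<close>

lemma integral_wasserstein_le_mixing_rate:
  assumes "t \<in> T" "s \<in> T"
  shows "(\<integral>\<omega>. wasserstein (transition P M t (M s \<omega>)) \<pi> \<partial>P x) \<le> mixing_rate x t"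
proof -
  have "M s \<in> P x \<rightarrow>\<^sub>M borel" using measurable_M[OF assms(2)] by (simp add: measurable_cong_sets[OF sets_P refl])
  then have "(\<integral>\<omega>. wasserstein (transition P M t (M s \<omega>)) \<pi> \<partial>P x)
      = (\<integral>y. wasserstein (transition P M t y) \<pi> \<partial>transition P M s x)"
    unfolding transition_def[of P M s x]
    by (rule integral_distr[symmetric]) (rule wasserstein_transition(1)[OF assms(1)])
  also have "\<dots> \<le> mixing_rate x t" unfolding mixing_rate_def
    using integral_wasserstein_bounds(2)[OF assms(1)] assms(2)
    by (intro cSUP_upper bdd_aboveI2[of _ _ 1]) auto
  finally show ?thesis .
qed

lemma mixing_rate_bounds:
  assumes "t \<in> T" shows "0 \<le> mixing_rate x t" "mixing_rate x t \<le> 1"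
proof -
  have "0 \<le> (\<integral>y. wasserstein (transition P M t y) \<pi> \<partial>transition P M 0 x)"
    by (rule integral_wasserstein_bounds[OF assms T_zero])
  also have "\<dots> \<le> mixing_rate x t" unfolding mixing_rate_def
    using integral_wasserstein_bounds(2)[OF assms] T_zero
    by (intro cSUP_upper bdd_aboveI2[of _ _ 1]) auto
  finally show "0 \<le> mixing_rate x t" .
  show "mixing_rate x t \<le> 1" unfolding mixing_rate_def
    by (rule cSUP_least) (use integral_wasserstein_bounds(2)[OF assms] T_zero in auto)
qed

section \<open>Correlations of a centered Lipschitz function along the process\<close>

definition centered :: "('a \<Rightarrow> real) \<Rightarrow> 'a \<Rightarrow> real" where
  "centered f x = f x - (\<integral>y. f y \<partial>\<pi>)"

context
  fixes f :: "'a \<Rightarrow> real" and L :: real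
  assumes f: "L-lipschitz_on UNIV f" and L: "L > 0"
begin

lemma centered_measurable: "centered f \<in> borel_measurable borel"
  using lipschitz_borel_measurable[OF f] unfolding centered_def by measurable

lemma centered_bound: "\<bar>centered f x\<bar> \<le> L"
  unfolding centered_def by (rule lipschitz_centered_bound[OF dist_le_1 f \<pi>])

text \<open>Conditioning at time \<open>s\<close> replaces \<open>centered f (M u \<omega>)\<close>
  by its kernel integral. That is the difference of the integrals of \<open>f\<close> against the
  kernel and \<open>\<pi>\<close>, hence at most \<open>L\<close> times their Wasserstein distance.
  The weight is at most 1 and drops out.\<close>

lemma weighted_correlation_bound:
  assumes s: "s \<in> T" and u: "u \<in> T" "s \<le> u"
    and h: "h \<in> borel_measurable (Ft s)" "\<And>\<omega>. 0 \<le> h \<omega>" "\<And>\<omega>. h \<omega> \<le> 1"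
  shows "\<bar>\<integral>\<omega>. h \<omega> * centered f (M u \<omega>) \<partial>P x\<bar> \<le> L * mixing_rate x (u - s)"
proof -
  interpret P: prob_space "P x" by (rule prob_space_P)
  define r where "r = u - s"
  have r: "r \<in> T" using T_diff[OF s u] by (simp add: r_def)
  let ?K = "\<lambda>\<omega>. transition P M r (M s \<omega>)"
  have K: "?K \<omega> \<in> prob_measures" for \<omega> by (rule transition_prob_measures[OF r])
  have meas: "(\<lambda>\<omega>. wasserstein (?K \<omega>) \<pi>) \<in> borel_measurable (P x)"
    using measurable_compose[OF measurable_M[OF s] wasserstein_transition(1)[OF r]]
    by (simp add: measurable_cong_sets[OF sets_P refl])
  have "\<bar>\<integral>\<omega>. h \<omega> * centered f (M u \<omega>) \<partial>P x\<bar> = \<bar>\<integral>\<omega>. h \<omega> * (\<integral>y. centered f y \<partial>?K \<omega>) \<partial>P x\<bar>"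
    using markov_integral[OF s u h centered_measurable centered_bound] by (simp add: r_def)
  also have "\<dots> \<le> (\<integral>\<omega>. \<bar>h \<omega> * (\<integral>y. centered f y \<partial>?K \<omega>)\<bar> \<partial>P x)" by (rule integral_abs_bound)
  also have "\<dots> \<le> (\<integral>\<omega>. L * wasserstein (?K \<omega>) \<pi> \<partial>P x)"
  proof (rule integral_mono_AE')
    show "integrable (P x) (\<lambda>\<omega>. L * wasserstein (?K \<omega>) \<pi>)"
      using wasserstein_transition(2,3)[OF r] meas
      by (intro integrable_mult_right P.integrable_const_bound[of _ 1]) auto
    show "AE \<omega> in P x. \<bar>h \<omega> * (\<integral>y. centered f y \<partial>?K \<omega>)\<bar> \<le> L * wasserstein (?K \<omega>) \<pi>"
    proof (rule AE_I2)
      fix \<omega>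
      interpret K: prob_space "?K \<omega>" using K prob_measuresD by blast
      have "(\<integral>y. centered f y \<partial>?K \<omega>) = (\<integral>y. f y \<partial>?K \<omega>) - (\<integral>y. f y \<partial>\<pi>)"
        unfolding centered_def using lipschitz_integrable[OF dist_le_1 f K] by (simp add: K.prob_space)
      then have "\<bar>\<integral>y. centered f y \<partial>?K \<omega>\<bar> \<le> L * wasserstein (?K \<omega>) \<pi>"
        using lipschitz_integral_le_wasserstein[OF dist_le_1 f L K \<pi>] by simp
      moreover have "h \<omega> * \<bar>\<integral>y. centered f y \<partial>?K \<omega>\<bar> \<le> 1 * \<bar>\<integral>y. centered f y \<partial>?K \<omega>\<bar>"
        using h by (intro mult_right_mono) auto
      ultimately show "\<bar>h \<omega> * (\<integral>y. centered f y \<partial>?K \<omega>)\<bar> \<le> L * wasserstein (?K \<omega>) \<pi>"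
        using h(2)[of \<omega>] by (simp add: abs_mult)
    qed
    show "AE \<omega> in P x. 0 \<le> L * wasserstein (?K \<omega>) \<pi>"
      using L wasserstein_transition(2)[OF r] by simp
  qed
  also have "\<dots> \<le> L * mixing_rate x r"
    using integral_wasserstein_le_mixing_rate[OF r s, of x] L by simp
  finally show ?thesis by (simp add: r_def)
qed

lemma centered_M_measurable:
  assumes "u \<in> T" shows "(\<lambda>\<omega>. centered f (M u \<omega>)) \<in> borel_measurable (P x)"
  using measurable_compose[OF measurable_M[OF assms] centered_measurable]
  by (simp add: measurable_cong_sets[OF sets_P refl])

text \<open>The product is symmetric, so \<open>s \<le> u\<close> may be assumed. Undoing the
  rescaling of the earlier factor costs 2L times the weighted bound plus L times the bound for
  weight 1; each bound is \<open>L\<close> times the mixing rate, whence the factor 3.\<close>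

lemma correlation_bound:
  assumes "s \<in> T" "u \<in> T"
  shows "\<bar>\<integral>\<omega>. centered f (M u \<omega>) * centered f (M s \<omega>) \<partial>P x\<bar> \<le> 3 * L\<^sup>2 * mixing_rate x \<bar>u - s\<bar>"
  using assms
proof (induction s u rule: linorder_wlog)
  case (le s u)
  interpret P: prob_space "P x" by (rule prob_space_P)
  note s = le(2) and u = le(3,1)
  let ?m = "mixing_rate x (u - s)"
  \<comment> \<open>\<open>h\<close> rescales \<open>centered f (M s)\<close> to a weight with values in \<open>[0,1]\<close>.\<close>
  let ?h = "\<lambda>\<omega>. (centered f (M s \<omega>) + L) / (2 * L)"
  have "?h \<in> borel_measurable (Ft s)"
    using measurable_compose[OF adapted[OF s] centered_measurable] by measurable
  moreover have "0 \<le> ?h \<omega>" "?h \<omega> \<le> 1" for \<omega>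
    using centered_bound[of "M s \<omega>"] L by (auto simp: field_simps abs_le_iff)
  ultimately have 1: "\<bar>\<integral>\<omega>. ?h \<omega> * centered f (M u \<omega>) \<partial>P x\<bar> \<le> L * ?m"
    by (rule weighted_correlation_bound[OF s u])
  have 2: "\<bar>\<integral>\<omega>. centered f (M u \<omega>) \<partial>P x\<bar> \<le> L * ?m"
    using weighted_correlation_bound[OF s u, of "\<lambda>_. 1" x] by simp
  have int: "integrable (P x) (\<lambda>\<omega>. centered f (M u \<omega>))"
    using centered_bound centered_M_measurable[OF u(1)] by (intro P.integrable_const_bound[of _ L]) auto
  have int2: "integrable (P x) (\<lambda>\<omega>. centered f (M u \<omega>) * centered f (M s \<omega>))"
    using centered_bound centered_M_measurable[OF u(1), of x] centered_M_measurable[OF s, of x] L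
    by (intro P.integrable_const_bound[of _ "L * L"]) (auto simp: abs_mult intro!: mult_mono)
  have "(\<integral>\<omega>. ?h \<omega> * centered f (M u \<omega>) \<partial>P x)
      = (\<integral>\<omega>. (centered f (M u \<omega>) * centered f (M s \<omega>) + L * centered f (M u \<omega>)) / (2 * L) \<partial>P x)"
    by (simp add: algebra_simps)
  also have "\<dots> = ((\<integral>\<omega>. centered f (M u \<omega>) * centered f (M s \<omega>) \<partial>P x) + L * (\<integral>\<omega>. centered f (M u \<omega>) \<partial>P x)) / (2 * L)"
    using int int2 by (simp add: L)
  finally have eq: "(\<integral>\<omega>. centered f (M u \<omega>) * centered f (M s \<omega>) \<partial>P x)
      = 2 * L * (\<integral>\<omega>. ?h \<omega> * centered f (M u \<omega>) \<partial>P x) - L * (\<integral>\<omega>. centered f (M u \<omega>) \<partial>P x)"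
    using L by (simp add: field_simps)
  have "\<bar>\<integral>\<omega>. centered f (M u \<omega>) * centered f (M s \<omega>) \<partial>P x\<bar> 
      \<le> \<bar>2 * L * (\<integral>\<omega>. ?h \<omega> * centered f (M u \<omega>) \<partial>P x)\<bar> + \<bar>L * (\<integral>\<omega>. centered f (M u \<omega>) \<partial>P x)\<bar>"
    unfolding eq by (rule abs_triangle_ineq4)
  also have "\<dots> = 2 * L * \<bar>\<integral>\<omega>. ?h \<omega> * centered f (M u \<omega>) \<partial>P x\<bar> + L * \<bar>\<integral>\<omega>. centered f (M u \<omega>) \<partial>P x\<bar>"
    using L by (simp only: abs_mult abs_numeral abs_of_pos)
  also have "\<dots> \<le> 2 * L * (L * ?m) + L * (L * ?m)"
    using 1 2 L by (intro add_mono mult_left_mono) auto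
  finally show ?case using u by (simp add: power2_eq_square algebra_simps)
next
  case (sym s u)
  then show ?case by (simp add: mult.commute abs_minus_commute)
qed

lemma centered_window_measurable:
  assumes "t \<in> T"
  shows "(\<lambda>(s, \<omega>). centered f (M s \<omega>)) \<in> borel_measurable (time_window T t \<Otimes>\<^sub>M \<F>)"
  using measurable_compose[OF jointly_measurable[OF assms] centered_measurable]
  by (simp add: case_prod_unfold)

text \<open>For fixed \<open>u\<close>, lags up to \<open>k\<close> have measure at most 2k + 1 and
  rate at most 1, and longer lags have measure at most \<open>t\<close> and rate at most
  \<open>e\<close>. Integrating over \<open>u\<close> contributes the last factor
  \<open>t\<close>.\<close>

lemma second_moment_bound:
  assumes t: "t \<in> T" and e: "0 \<le> e" and rate: "\<And>r. r \<in> T \<Longrightarrow> real k < r \<Longrightarrow> mixing_rate x r \<le> e"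
  shows "(\<integral>\<omega>. (\<integral>s. centered f (M s \<omega>) \<partial>time_window T t)\<^sup>2 \<partial>P x) \<le> 3 * L\<^sup>2 * (2 * real k + 1 + e * t) * t"
proof -
  let ?N = "time_window T t"
  interpret N: finite_measure ?N by (rule finite_measure_time_window[OF time_set t])
  interpret P: prob_space "P x" by (rule prob_space_P)
  have meas[measurable]: "(\<lambda>(s, \<omega>). centered f (M s \<omega>)) \<in> borel_measurable (?N \<Otimes>\<^sub>M P x)"
    using centered_window_measurable[OF t]
    by (simp add: measurable_cong_sets[OF sets_pair_measure_cong[OF refl sets_P] refl])
  define c where "c u s = (\<integral>\<omega>. centered f (M u \<omega>) * centered f (M s \<omega>) \<partial>P x)" for u s
  \<comment> \<open>\<open>c\<close> is an integral over \<open>\<omega>\<close> of a product that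
    is jointly measurable in \<open>u\<close>, \<open>s\<close> and \<open>\<omega>\<close>: each
    factor is the window map composed with projections.\<close>
  have cm[measurable]: "(\<lambda>(u, s). c u s) \<in> borel_measurable (?N \<Otimes>\<^sub>M ?N)"
    unfolding c_def case_prod_unfold
  proof (rule P.borel_measurable_lebesgue_integral[unfolded case_prod_unfold])
    have "(\<lambda>z. centered f (M (fst (fst z)) (snd z))) \<in> borel_measurable ((?N \<Otimes>\<^sub>M ?N) \<Otimes>\<^sub>M P x)"
      "(\<lambda>z. centered f (M (snd (fst z)) (snd z))) \<in> borel_measurable ((?N \<Otimes>\<^sub>M ?N) \<Otimes>\<^sub>M P x)"
      using measurable_compose[OF _ meas, of "\<lambda>z. (fst (fst z), snd z)" "(?N \<Otimes>\<^sub>M ?N) \<Otimes>\<^sub>M P x"]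
        measurable_compose[OF _ meas, of "\<lambda>z. (snd (fst z), snd z)" "(?N \<Otimes>\<^sub>M ?N) \<Otimes>\<^sub>M P x"]
      by auto
    then show "(\<lambda>z. centered f (M (fst (fst z)) (snd z)) * centered f (M (snd (fst z)) (snd z)))
        \<in> borel_measurable ((?N \<Otimes>\<^sub>M ?N) \<Otimes>\<^sub>M P x)" by measurable
  qed
  have t0: "0 \<le> t" using t time_set by (auto simp: time_set_def elim: Nats_cases)
  \<comment> \<open>The indicator stands for the trivial rate bound 1 at short lags and
    \<open>e\<close> for the assumed bound at the others; their sum covers both cases.\<close>
  have c_bound: "c u s \<le> 3 * L\<^sup>2 * (indicator {s \<in> space ?N. \<bar>s - u\<bar> \<le> real k} s + e)"
    if u: "u \<in> space ?N" and s: "s \<in> space ?N" for u s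
  proof -
    have T: "u \<in> T" "s \<in> T" "\<bar>u - s\<bar> \<in> T"
      using u s T_diff[of u s] T_diff[of s u] by (auto simp: space_time_window[OF time_set] abs_if)
    have "mixing_rate x \<bar>u - s\<bar> \<le> indicator {s \<in> space ?N. \<bar>s - u\<bar> \<le> real k} s + e"
      using rate[OF T(3)] mixing_rate_bounds(2)[OF T(3), of x] s e
      by (auto simp: indicator_def abs_minus_commute not_le)
    then have "3 * L\<^sup>2 * mixing_rate x \<bar>u - s\<bar> \<le> 3 * L\<^sup>2 * (indicator {s \<in> space ?N. \<bar>s - u\<bar> \<le> real k} s + e)"
      by (intro mult_left_mono) auto
    then show ?thesis using correlation_bound[OF T(2,1), of x] by (simp add: c_def)
  qed
  \<comment> \<open>A crude bound, valid for all real \<open>u\<close> and \<open>s\<close>, that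
    supplies the integrability of \<open>c u\<close>.\<close>
  have c_le: "\<bar>c u s\<bar> \<le> L * L" for u s
  proof -
    have "\<bar>c u s\<bar> \<le> (\<integral>\<omega>. \<bar>centered f (M u \<omega>) * centered f (M s \<omega>)\<bar> \<partial>P x)"
      unfolding c_def by (rule integral_abs_bound)
    also have "\<dots> \<le> (\<integral>\<omega>. L * L \<partial>P x)"
      by (rule integral_mono_AE') (use centered_bound L in \<open>auto simp: abs_mult intro!: mult_mono\<close>)
    finally show ?thesis by (simp add: P.prob_space)
  qed
  have inner: "(\<integral>s. c u s \<partial>?N) \<le> 3 * L\<^sup>2 * (2 * real k + 1 + e * t)" if u: "u \<in> space ?N" for u
  proof -
    have [measurable]: "{s \<in> space ?N. \<bar>s - u\<bar> \<le> real k} \<in> sets ?N"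
      by (rule sets_time_window_interval[OF time_set])
    have uT: "u \<in> T" using u by (simp add: space_time_window[OF time_set])
    have cu: "c u \<in> borel_measurable ?N" using measurable_Pair2[OF cm u] by simp
    have "(\<integral>s. c u s \<partial>?N) \<le> (\<integral>s. 3 * L\<^sup>2 * (indicator {s \<in> space ?N. \<bar>s - u\<bar> \<le> real k} s + e) \<partial>?N)"
      using c_bound[OF u] c_le cu
      by (intro integral_mono integrable_mult_right Bochner_Integration.integrable_add
          N.integrable_const_bound[of "c u" "L * L"])
         (auto intro!: integrable_real_indicator simp: N.emeasure_finite less_top[symmetric])
    also have "\<dots> = 3 * L\<^sup>2 * (measure ?N {s \<in> space ?N. \<bar>s - u\<bar> \<le> real k} + e * t)"
      using t by (subst integral_mult_right_zero, subst Bochner_Integration.integral_add)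
        (auto intro!: integrable_real_indicator simp: N.emeasure_finite less_top[symmetric]
          measure_time_window_space[OF time_set])
    also have "\<dots> \<le> 3 * L\<^sup>2 * (2 * real k + 1 + e * t)"
      using measure_time_window_interval[OF time_set t uT, of k] by (intro mult_left_mono) auto
    finally show ?thesis .
  qed
  have "(\<integral>\<omega>. (\<integral>s. centered f (M s \<omega>) \<partial>?N)\<^sup>2 \<partial>P x) = (\<integral>u. \<integral>s. c u s \<partial>?N \<partial>?N)"
    unfolding c_def using centered_bound
    by (intro second_moment_Fubini N.finite_measure_axioms P.finite_measure_axioms meas)
  also have "\<dots> \<le> (\<integral>u. 3 * L\<^sup>2 * (2 * real k + 1 + e * t) \<partial>?N)"
    by (rule integral_mono_AE') (use inner e t0 in auto)
  also have "\<dots> = 3 * L\<^sup>2 * (2 * real k + 1 + e * t) * t"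
    using t by (simp add: measure_time_window_space[OF time_set])
  finally show ?thesis .
qed

end

end

text \<open>Scaling a measure amounts to a constant density.\<close>

lemma integral_scale_measure:
  fixes g :: "'a \<Rightarrow> real"
  assumes "0 \<le> c" "g \<in> borel_measurable N"
  shows "(\<integral>x. g x \<partial>scale_measure (ennreal c) N) = c * (\<integral>x. g x \<partial>N)"
proof -
  have "scale_measure (ennreal c) N = density N (\<lambda>_. ennreal c)"
    by (rule measure_eqI) (auto simp: emeasure_density nn_integral_cmult)
  then show ?thesis using assms by (simp add: integral_density)
qed

section \<open>Weak convergence\<close>

text \<open>A bounded continuous function is a limit from below of bounded Lipschitz functions. This
  yields an asymptotic lower bound for its integrals, and the negated function yields the upper
  bound.\<close>

lemma tendsto_weakly_lipschitzI:
  fixes N :: "'t \<Rightarrow> 'a::metric_space measure"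
  assumes N: "\<forall>\<^sub>F t in F. N t \<in> prob_measures" and \<nu>: "\<nu> \<in> prob_measures"
    and lip: "\<And>(f :: 'a \<Rightarrow> real) L. L-lipschitz_on UNIV f \<Longrightarrow> bounded (range f) \<Longrightarrow>
      ((\<lambda>t. \<integral>x. f x \<partial>N t) \<longlongrightarrow> (\<integral>x. f x \<partial>\<nu>)) F"
  shows "tendsto_weakly N \<nu> F"
proof -
  interpret \<nu>: prob_space \<nu> using prob_measuresD[OF \<nu>] by simp
  have lower: "\<forall>\<^sub>F t in F. (\<integral>x. g x \<partial>\<nu>) - e < (\<integral>x. g x \<partial>N t)"
    if g: "continuous_on UNIV g" and bdd: "bounded (range g)" and e: "e > 0" for g :: "'a \<Rightarrow> real" and e :: real
  proof -
    obtain B where B: "\<And>x. \<bar>g x\<bar> \<le> B" using bdd by (auto simp: bounded_iff)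
    have gm: "g \<in> borel_measurable borel" using g by (rule borel_measurable_continuous_onI)
    \<comment> \<open>Lipschitz functions increasing to \<open>g\<close>\<close>
    define h where "h n x = (INF y. g y + real n * dist x y)" for n x
    have below: "bdd_below (range (\<lambda>y. g y + real n * dist x y))" for n x
    proof (rule bdd_belowI2)
      fix y show "- B \<le> g y + real n * dist x y" using B[of y] by (smt (verit) mult_nonneg_nonneg of_nat_0_le_iff zero_le_dist)
    qed
    have h_le: "h n x \<le> g y + real n * dist x y" for n x y
      unfolding h_def by (rule cINF_lower[OF below]) simp
    have h_ge: "c \<le> h n x" if "\<And>y. c \<le> g y + real n * dist x y" for c n x
      unfolding h_def by (rule cINF_greatest) (use that in auto)
    have h_B: "\<bar>h n x\<bar> \<le> B" for n x
    proof -
      have "- B \<le> h n x"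
      proof (rule h_ge)
        fix y show "- B \<le> g y + real n * dist x y" using B[of y] by (smt (verit) mult_nonneg_nonneg of_nat_0_le_iff zero_le_dist)
      qed
      then show ?thesis using h_le[of n x x] B[of x] by auto
    qed
    have h_lip: "(real n)-lipschitz_on UNIV (h n)" for n
    proof (rule lipschitz_onI)
      have *: "h n x - real n * dist x y \<le> h n y" for x y
      proof (rule h_ge)
        fix z
        have "real n * dist x z \<le> real n * (dist x y + dist y z)"
          by (intro mult_left_mono dist_triangle) auto
        then show "h n x - real n * dist x y \<le> g z + real n * dist y z"
          using h_le[of n x z] by (simp add: algebra_simps)
      qed
      fix x y show "dist (h n x) (h n y) \<le> real n * dist x y"
        using *[of x y] *[of y x] by (simp add: dist_real_def dist_commute abs_le_iff)
    qed simp
    have h_meas: "h n \<in> borel_measurable borel" for n using h_lip by (rule lipschitz_borel_measurable)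
    have h_lim: "(\<lambda>n. h n x) \<longlonglongrightarrow> g x" for x
    proof (rule LIMSEQ_I)
      fix r :: real assume r: "r > 0"
      obtain d where d: "d > 0" "\<And>y. dist y x < d \<Longrightarrow> dist (g y) (g x) < r / 2"
        using g r unfolding continuous_on_iff by (metis UNIV_I half_gt_zero)
      \<comment> \<open>Points at distance at least \<open>d\<close> from \<open>x\<close> then pay
        a penalty of at least \<open>2 * B\<close>, the most by which \<open>g\<close> can drop; at
        nearer points \<open>g\<close> drops by less than \<open>r / 2\<close>.\<close>
      obtain n0 where n0: "2 * B / d \<le> real n0" using real_arch_simple by blast
      have "norm (h n x - g x) < r" if n: "n \<ge> n0" for n
      proof -
        have "g x - r / 2 \<le> h n x"
        proof (rule h_ge)
          fix y show "g x - r / 2 \<le> g y + real n * dist x y"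
          proof (cases "dist y x < d")
            case True
            then have "g x - r / 2 \<le> g y" using d(2)[OF True] unfolding dist_real_def by linarith
            moreover have "0 \<le> real n * dist x y" by simp
            ultimately show ?thesis by linarith
          next
            case False
            have "2 * B \<le> real n0 * d" using n0 d(1) by (simp add: field_simps)
            also have "\<dots> \<le> real n * dist x y"
              using n False d(1) by (intro mult_mono) (auto simp: dist_commute)
            finally show ?thesis using B[of x] B[of y] r by (simp add: abs_le_iff)
          qed
        qed
        then show ?thesis using h_le[of n x x] r by (simp add: abs_less_iff)
      qed
      then show "\<exists>n0. \<forall>n\<ge>n0. norm (h n x - g x) < r" by blast
    qed
    have mb: "k \<in> borel_measurable \<nu>" if "k \<in> borel_measurable borel" for k :: "'a \<Rightarrow> real"
      using that by (simp add: measurable_cong_sets[OF prob_measuresD(2)[OF \<nu>] refl])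
    have "(\<lambda>n. \<integral>x. h n x \<partial>\<nu>) \<longlonglongrightarrow> (\<integral>x. g x \<partial>\<nu>)"
      using h_lim h_B mb[OF h_meas] mb[OF gm]
      by (intro integral_dominated_convergence[where w="\<lambda>_. B"]) auto
    then have "\<forall>\<^sub>F n in sequentially. (\<integral>x. g x \<partial>\<nu>) - e < (\<integral>x. h n x \<partial>\<nu>)"
      by (rule order_tendstoD) (use e in simp)
    \<comment> \<open>From here a single Lipschitz minorant \<open>h n\<close> is kept fixed while
      \<open>t\<close> varies.\<close>
    then obtain n where n: "(\<integral>x. g x \<partial>\<nu>) - e < (\<integral>x. h n x \<partial>\<nu>)"
      using eventually_happens'[OF sequentially_bot] by blast
    have "bounded (range (h n))" using h_B by (auto simp: bounded_iff)
    from order_tendstoD(1)[OF lip[OF h_lip[of n] this] n] N show ?thesis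
    proof eventually_elim
      case (elim t)
      have "(\<integral>x. h n x \<partial>N t) \<le> (\<integral>x. g x \<partial>N t)"
        by (rule integral_mono[OF integrable_bounded_prob_measures[OF elim(2) h_meas h_B]
              integrable_bounded_prob_measures[OF elim(2) gm B]]) (use h_le[of n x x for x] in simp)
      then show ?case using elim by linarith
    qed
  qed
  have "((\<lambda>t. \<integral>x. g x \<partial>N t) \<longlongrightarrow> (\<integral>x. g x \<partial>\<nu>)) F"
    if g: "continuous_on UNIV g" "bounded (range g)" for g :: "'a \<Rightarrow> real"
  proof (rule order_tendstoI)
    fix a assume "a < (\<integral>x. g x \<partial>\<nu>)"
    then show "\<forall>\<^sub>F t in F. a < (\<integral>x. g x \<partial>N t)" using lower[OF g, of "(\<integral>x. g x \<partial>\<nu>) - a"] by simp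
  next
    fix a assume a: "(\<integral>x. g x \<partial>\<nu>) < a"
    have "continuous_on UNIV (\<lambda>x. - g x)" "bounded (range (\<lambda>x. - g x))"
      using g by (auto intro: continuous_on_minus simp: bounded_iff)
    from lower[OF this, of "a - (\<integral>x. g x \<partial>\<nu>)"] a
    show "\<forall>\<^sub>F t in F. (\<integral>x. g x \<partial>N t) < a" by (auto elim: eventually_mono)
  qed
  then show ?thesis using N \<nu> by (auto simp: tendsto_weakly_def)
qed

section \<open>Time averages and mean measures\<close>

lemma time_average_eq:
  assumes "time_set T"
  shows "time_average T M f t \<omega> = (1 / t) * (\<integral>s. f (M s \<omega>) \<partial>time_window T t)"
proof -
  \<comment> \<open>\<open>{0..<t}\<close> need not lie inside the time set, so only its trace there
    is shown to be measurable.\<close>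
  have "{0..<t} \<inter> space (time_measure T) \<in> sets (time_measure T)"
    using assms by (auto simp: time_set_def time_measure_def nonneg_ne_Nats space_restrict_space
        sets_restrict_space_iff intro!: image_eqI)
  then show ?thesis
    by (simp add: time_average_def set_lebesgue_integral_def time_window_def integral_restrict_space)
qed

context markov_process
begin

lemma path_measurable:
  assumes "t \<in> T" "\<omega> \<in> space \<F>" shows "(\<lambda>s. M s \<omega>) \<in> time_window T t \<rightarrow>\<^sub>M borel"
  using measurable_Pair1[OF jointly_measurable[OF assms(1)] assms(2)] by simp

lemma time_average_measurable:
  assumes t: "t \<in> T" and f: "f \<in> borel_measurable borel"
  shows "time_average T M f t \<in> borel_measurable \<F>"
proof -
  interpret N: finite_measure "time_window T t" by (rule finite_measure_time_window[OF time_set t])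
  have "(\<lambda>(\<omega>, s). f (M s \<omega>)) \<in> borel_measurable (\<F> \<Otimes>\<^sub>M time_window T t)"
    using measurable_compose[OF measurable_compose[OF measurable_pair_swap' jointly_measurable[OF t]] f]
    by (simp add: case_prod_unfold)
  then have "(\<lambda>\<omega>. \<integral>s. f (M s \<omega>) \<partial>time_window T t) \<in> borel_measurable \<F>"
    by (rule N.borel_measurable_lebesgue_integral)
  from borel_measurable_times[OF borel_measurable_const this, of "1 / t"] show ?thesis
    by (simp add: time_average_eq[OF time_set, abs_def])
qed

section \<open>The process started from an initial law\<close>

context
  fixes \<mu> :: "'a measure" assumes \<mu>: "\<mu> \<in> prob_measures"
begin

text \<open>\<open>\<mu> \<bind> P\<close> is the measure of the process with initial law
  \<open>\<mu>\<close>.\<close>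

lemma prob_space_start: "prob_space (\<mu> \<bind> P)" and sets_start: "sets (\<mu> \<bind> P) = sets \<F>"
proof -
  have \<mu>': "\<mu> \<in> space (prob_algebra borel)" using \<mu> by (simp add: prob_measures_prob_algebra)
  show "prob_space (\<mu> \<bind> P)" by (rule prob_space_bind'[OF \<mu>' kernel])
  show "sets (\<mu> \<bind> P) = sets \<F>" by (rule sets_bind'[OF \<mu>' kernel])
qed

lemma kernel_\<mu>: "P \<in> \<mu> \<rightarrow>\<^sub>M subprob_algebra \<F>"
  using measurable_prob_algebraD[OF kernel] by (simp add: measurable_cong_sets[OF prob_measuresD(2)[OF \<mu>] refl])

lemma integral_start:
  fixes g :: "'w \<Rightarrow> real"
  assumes "g \<in> borel_measurable \<F>" "\<And>\<omega>. \<omega> \<in> space \<F> \<Longrightarrow> \<bar>g \<omega>\<bar> \<le> B"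
  shows "(\<integral>\<omega>. g \<omega> \<partial>(\<mu> \<bind> P)) = (\<integral>x. (\<integral>\<omega>. g \<omega> \<partial>P x) \<partial>\<mu>)"
  by (rule integral_bind[OF assms kernel_\<mu> prob_space.finite_measure, where B'=1])
     (use prob_space.emeasure_space_1[OF prob_space_P] prob_measuresD[OF \<mu>] in auto)

text \<open>Pushing forward along \<open>M s\<close> commutes with mixing over the starting point,
  so the averaged transition laws at all times arise from one measure on
  \<open>\<F>\<close>.\<close>

lemma start_transition:
  assumes "s \<in> T" shows "\<mu> \<bind> transition P M s = distr (\<mu> \<bind> P) borel (M s)"
  using distr_bind[OF kernel_\<mu> _ measurable_M[OF assms]] prob_measuresD(3)[OF \<mu>]
  by (simp add: transition_def[abs_def])

context
  fixes t assumes t: "t \<in> T" and t_pos: "t > 0"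
begin

lemma window_subset: "s \<in> space (time_window T t) \<Longrightarrow> s \<in> T"
  by (simp add: space_time_window[OF time_set])

text \<open>Required by the bind rules below, since \<open>\<bind>\<close> takes a default value
  over an empty space.\<close>

lemma space_window_nonempty: "space (time_window T t) \<noteq> {}"
  using T_zero t_pos by (auto simp: space_time_window[OF time_set])

lemma mean_measure_eq:
  "mean_measure T P M \<mu> t = scale_measure (ennreal (1 / t))
     (time_window T t \<bind> (\<lambda>s. distr (\<mu> \<bind> P) borel (M s)))"
  unfolding mean_measure_def time_window_def[symmetric]
  by (intro arg_cong2[where f=scale_measure] refl bind_cong) (simp add: start_transition window_subset)

text \<open>Joint measurability of the process makes its one-dimensional laws depend measurably on
  time.\<close>

lemma window_kernel: "(\<lambda>s. distr (\<mu> \<bind> P) borel (M s)) \<in> time_window T t \<rightarrow>\<^sub>M prob_algebra borel"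
proof (rule measurable_distr_prob_space2[where M=\<F>])
  show "(\<lambda>s. \<mu> \<bind> P) \<in> time_window T t \<rightarrow>\<^sub>M prob_algebra \<F>"
    by (rule measurable_const) (simp add: space_prob_algebra prob_space_start sets_start)
qed (rule jointly_measurable[OF t])

lemma distr_M_prob_space:
  assumes "s \<in> space (time_window T t)" shows "prob_space (distr (\<mu> \<bind> P) borel (M s))"
  using measurable_space[OF window_kernel assms] by (simp add: space_prob_algebra)

lemma mean_measure_prob_measures: "mean_measure T P M \<mu> t \<in> prob_measures"
proof -
  note K = measurable_prob_algebraD[OF window_kernel]
  have sets: "sets (mean_measure T P M \<mu> t) = sets borel"
    by (simp add: mean_measure_eq sets_bind_measurable[OF K space_window_nonempty])
  have "emeasure (mean_measure T P M \<mu> t) UNIV = ennreal (1 / t) *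
     (\<integral>\<^sup>+s. emeasure (distr (\<mu> \<bind> P) borel (M s)) UNIV \<partial>time_window T t)"
    by (simp add: mean_measure_eq emeasure_bind[OF space_window_nonempty K])
  also have "(\<integral>\<^sup>+s. emeasure (distr (\<mu> \<bind> P) borel (M s)) UNIV \<partial>time_window T t)
      = (\<integral>\<^sup>+s. 1 \<partial>time_window T t)"
    using prob_space.emeasure_space_1[OF distr_M_prob_space] by (intro nn_integral_cong) simp
  also have "ennreal (1 / t) * \<dots> = 1"
    using t_pos by (simp add: emeasure_time_window_space[OF time_set t] flip: ennreal_mult)
  finally show ?thesis
    using sets sets_eq_imp_space_eq[OF sets] by (auto simp: prob_measures_def intro!: prob_spaceI)
qed

text \<open>Fubini exchanges the average over time with the expectation.\<close>

lemma integral_mean_measure: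
  fixes g :: "'a \<Rightarrow> real"
  assumes g: "g \<in> borel_measurable borel" and gB: "\<And>x. \<bar>g x\<bar> \<le> B"
  shows "(\<integral>x. g x \<partial>mean_measure T P M \<mu> t) = (\<integral>\<omega>. time_average T M g t \<omega> \<partial>(\<mu> \<bind> P))"
proof -
  let ?N = "time_window T t" and ?Q = "\<mu> \<bind> P"
  interpret N: finite_measure ?N by (rule finite_measure_time_window[OF time_set t])
  interpret Q: prob_space ?Q by (rule prob_space_start)
  interpret NQ: pair_sigma_finite ?N ?Q ..
  interpret NQ': finite_measure "?N \<Otimes>\<^sub>M ?Q" by (rule finite_measure_pair_measure) unfold_locales
  note K = measurable_prob_algebraD[OF window_kernel]
  have meas: "(\<lambda>(s, \<omega>). g (M s \<omega>)) \<in> borel_measurable (?N \<Otimes>\<^sub>M ?Q)"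
    using measurable_compose[OF jointly_measurable[OF t] g]
    by (simp add: case_prod_unfold measurable_cong_sets[OF sets_pair_measure_cong[OF refl sets_start] refl])
  have "(\<integral>x. g x \<partial>mean_measure T P M \<mu> t) = (1 / t) * (\<integral>x. g x \<partial>(?N \<bind> (\<lambda>s. distr ?Q borel (M s))))"
    unfolding mean_measure_eq using g t_pos
    by (intro integral_scale_measure)
       (auto simp: measurable_cong_sets[OF sets_bind_measurable[OF K space_window_nonempty] refl])
  also have "(\<integral>x. g x \<partial>(?N \<bind> (\<lambda>s. distr ?Q borel (M s)))) = (\<integral>s. (\<integral>x. g x \<partial>distr ?Q borel (M s)) \<partial>?N)"
    by (rule integral_bind[OF g gB K N.finite_measure_axioms, where B'=1])
       (use prob_space.emeasure_space_1[OF distr_M_prob_space] in auto)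
  also have "\<dots> = (\<integral>s. (\<integral>\<omega>. g (M s \<omega>) \<partial>?Q) \<partial>?N)"
    by (intro Bochner_Integration.integral_cong refl integral_distr g)
       (simp add: measurable_cong_sets[OF sets_start refl] measurable_M window_subset)
  also have "\<dots> = (\<integral>\<omega>. (\<integral>s. g (M s \<omega>) \<partial>?N) \<partial>?Q)"
    by (rule NQ.Fubini_integral[symmetric])
       (use gB meas in \<open>auto intro!: NQ'.integrable_const_bound[of _ B]\<close>)
  finally show ?thesis by (simp add: time_average_eq[OF time_set])
qed

end
end
end

section \<open>Convergence of time averages\<close>

context ergodic_markov_process
begin

text \<open>Squared, so that mean-square convergence of the averages becomes convergence of the
  means of a nonnegative function.\<close>

definition deviation :: "('a \<Rightarrow> real) \<Rightarrow> real \<Rightarrow> 'w \<Rightarrow> real" where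
  "deviation f t \<omega> = (time_average T M f t \<omega> - (\<integral>y. f y \<partial>\<pi>))\<^sup>2"

context
  fixes f :: "'a \<Rightarrow> real" and L :: real
  assumes f: "L-lipschitz_on UNIV f" and L: "L > 0"
begin

lemma time_average_centered:
  assumes t: "t \<in> T" "t > 0" and \<omega>: "\<omega> \<in> space \<F>"
  shows "time_average T M f t \<omega> - (\<integral>y. f y \<partial>\<pi>) = (\<integral>s. centered f (M s \<omega>) \<partial>time_window T t) / t"
proof -
  interpret N: finite_measure "time_window T t" by (rule finite_measure_time_window[OF time_set t(1)])
  have "integrable (time_window T t) (\<lambda>s. f (M s \<omega>))"
    using measurable_compose[OF path_measurable[OF t(1) \<omega>] lipschitz_borel_measurable[OF f]]
      lipschitz_bounded[OF dist_le_1 f, of _ undefined]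
    by (intro N.integrable_const_bound[of _ "\<bar>f undefined\<bar> + L"]) auto
  then have "(\<integral>s. centered f (M s \<omega>) \<partial>time_window T t)
      = (\<integral>s. f (M s \<omega>) \<partial>time_window T t) - t * (\<integral>y. f y \<partial>\<pi>)"
    by (simp add: centered_def measure_time_window_space[OF time_set t(1)])
  then show ?thesis using t by (simp add: time_average_eq[OF time_set] field_simps)
qed

text \<open>For \<open>t > 0\<close> the bound \<open>L\<close> suffices. At \<open>t = 0\<close>
  the factor \<open>1 / t\<close> is 0 and the average vanishes, which the second summand accounts
  for.\<close>

lemma time_average_bound:
  assumes t: "t \<in> T" and \<omega>: "\<omega> \<in> space \<F>"
  shows "\<bar>time_average T M f t \<omega> - (\<integral>y. f y \<partial>\<pi>)\<bar> \<le> L + \<bar>\<integral>y. f y \<partial>\<pi>\<bar>"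
proof (cases "t > 0")
  case True
  interpret N: finite_measure "time_window T t" by (rule finite_measure_time_window[OF time_set t(1)])
  have "\<bar>\<integral>s. centered f (M s \<omega>) \<partial>time_window T t\<bar> \<le> (\<integral>s. \<bar>centered f (M s \<omega>)\<bar> \<partial>time_window T t)"
    by (rule integral_abs_bound)
  also have "\<dots> \<le> (\<integral>s. L \<partial>time_window T t)"
    by (rule integral_mono_AE') (use centered_bound[OF f] L in auto)
  also have "\<dots> = L * t" by (simp add: measure_time_window_space[OF time_set t(1)])
  finally have "\<bar>time_average T M f t \<omega> - (\<integral>y. f y \<partial>\<pi>)\<bar> \<le> L"
    using True by (simp add: time_average_centered[OF t True \<omega>] field_simps)
  then show ?thesis by linarith
next
  case False
  then have "t = 0" using t time_set by (auto simp: time_set_def elim!: Nats_cases)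
  then show ?thesis using L by (simp add: time_average_def)
qed

lemma deviation_nonneg: "0 \<le> deviation f t \<omega>"
  by (simp add: deviation_def)

lemma deviation_measurable: "t \<in> T \<Longrightarrow> deviation f t \<in> borel_measurable \<F>"
  unfolding deviation_def
  by (intro borel_measurable_power borel_measurable_diff borel_measurable_const
      time_average_measurable lipschitz_borel_measurable[OF f])

lemma deviation_bound:
  assumes "t \<in> T" "\<omega> \<in> space \<F>"
  shows "\<bar>deviation f t \<omega>\<bar> \<le> (L + \<bar>\<integral>y. f y \<partial>\<pi>\<bar>)\<^sup>2"
  using time_average_bound[OF assms] L unfolding deviation_def by (simp add: abs_le_square_iff[symmetric])

lemma deviation_tendsto_P:
  "((\<lambda>t. \<integral>\<omega>. deviation f t \<omega> \<partial>P x) \<longlongrightarrow> 0) (time_at_top T)"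
proof (rule order_tendstoI)
  fix a :: real assume "a < 0"
  then show "\<forall>\<^sub>F t in time_at_top T. a < (\<integral>\<omega>. deviation f t \<omega> \<partial>P x)"
    using Bochner_Integration.integral_nonneg[of "P x" "deviation f _"] deviation_nonneg
    by (auto intro!: always_eventually less_le_trans[OF \<open>a < 0\<close>])
next
  fix a :: real assume a: "a > 0"
  \<comment> \<open>With this choice \<open>3 * L\<^sup>2 * e\<close> equals \<open>a / 2\<close>,
    the share of the long lags after division by \<open>t\<^sup>2\<close>.\<close>
  define e where "e = a / (6 * L\<^sup>2)"
  have e: "e > 0" using a L by (simp add: e_def)
  have "\<forall>\<^sub>F t in time_at_top T. mixing_rate x t < e"
    using order_tendstoD(2)[OF ergodic e] unfolding mixing_rate_def .
  then obtain K where K: "\<And>r. r \<in> T \<Longrightarrow> K \<le> r \<Longrightarrow> mixing_rate x r < e"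
    unfolding eventually_time_at_top eventually_at_top_linorder by blast
  \<comment> \<open>Rounded up because the window slices have natural radius; \<open>k < r\<close>
    then implies \<open>K \<le> r\<close>.\<close>
  define k where "k = nat \<lceil>K\<rceil>"
  have k: "mixing_rate x r \<le> e" if "r \<in> T" "real k < r" for r
    using K[of r] that real_nat_ceiling_ge[of K] by (simp add: k_def)
  \<comment> \<open>The threshold makes the share of the short lags,
    \<open>3 * L\<^sup>2 * (2 * real k + 1) / t\<close>, less than \<open>a / 2\<close>.\<close>
  have "\<forall>\<^sub>F t in at_top. 6 * L\<^sup>2 * (2 * real k + 1) / a < t" by (rule eventually_gt_at_top)
  then show "\<forall>\<^sub>F t in time_at_top T. (\<integral>\<omega>. deviation f t \<omega> \<partial>P x) < a"
    unfolding eventually_time_at_top using eventually_gt_at_top[of 0]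
  proof eventually_elim
    case (elim t)
    show ?case
    proof
      assume t: "t \<in> T"
      have "(\<integral>\<omega>. deviation f t \<omega> \<partial>P x) = (\<integral>\<omega>. (\<integral>s. centered f (M s \<omega>) \<partial>time_window T t)\<^sup>2 / t\<^sup>2 \<partial>P x)"
        by (intro Bochner_Integration.integral_cong refl)
           (simp add: deviation_def time_average_centered[OF t elim(2)] space_P power_divide)
      also have "\<dots> = (\<integral>\<omega>. (\<integral>s. centered f (M s \<omega>) \<partial>time_window T t)\<^sup>2 \<partial>P x) / t\<^sup>2" by simp
      also have "\<dots> \<le> 3 * L\<^sup>2 * (2 * real k + 1 + e * t) * t / t\<^sup>2"
        using second_moment_bound[OF f L t _ k] e by (intro divide_right_mono) auto
      also have "\<dots> = 3 * L\<^sup>2 * (2 * real k + 1) / t + a / 2"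
        using elim L by (simp add: e_def field_simps power2_eq_square)
      also have "\<dots> < a / 2 + a / 2" using elim a L by (simp add: field_simps)
      finally show "(\<integral>\<omega>. deviation f t \<omega> \<partial>P x) < a" by simp
    qed
  qed
qed

text \<open>The speed of convergence may depend on the starting point, so dominated convergence in
  \<open>x\<close> is used, with the bound of \<open>deviation_bound\<close>, which is uniform in
  time.\<close>

lemma deviation_tendsto:
  assumes \<mu>: "\<mu> \<in> prob_measures"
  shows "((\<lambda>t. \<integral>\<omega>. deviation f t \<omega> \<partial>(\<mu> \<bind> P)) \<longlongrightarrow> 0) (time_at_top T)"
proof -
  interpret \<mu>: prob_space \<mu> using prob_measuresD[OF \<mu>] by simp
  let ?B = "(L + \<bar>\<integral>y. f y \<partial>\<pi>\<bar>)\<^sup>2"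
  let ?D = "\<lambda>t x. if t \<in> T then \<integral>\<omega>. deviation f t \<omega> \<partial>P x else 0"
  have "((\<lambda>t. \<integral>x. ?D t x \<partial>\<mu>) \<longlongrightarrow> (\<integral>x. 0 \<partial>\<mu>)) at_top"
  proof (rule integral_dominated_convergence_at_top[where w="\<lambda>_. ?B"])
    show "?D t \<in> borel_measurable \<mu>" for t
      using measurable_compose[OF kernel_\<mu>[OF \<mu>] integral_measurable_subprob_algebra[OF deviation_measurable]]
      by (cases "t \<in> T") simp_all
    show "AE x in \<mu>. ((\<lambda>t. ?D t x) \<longlongrightarrow> 0) at_top"
      using deviation_tendsto_P by (auto simp: tendsto_time_at_top_iff)
    have "norm (?D t x) \<le> ?B" for t x
    proof (cases "t \<in> T")
      case True
      interpret P: prob_space "P x" by (rule prob_space_P)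
      have "\<bar>\<integral>\<omega>. deviation f t \<omega> \<partial>P x\<bar> \<le> (\<integral>\<omega>. \<bar>deviation f t \<omega>\<bar> \<partial>P x)" by (rule integral_abs_bound)
      also have "\<dots> \<le> (\<integral>\<omega>. ?B \<partial>P x)"
        by (rule integral_mono_AE') (use deviation_bound[OF True] in \<open>auto simp: space_P intro!: AE_I2\<close>)
      finally show ?thesis using True by (simp add: P.prob_space)
    qed simp
    then show "\<forall>\<^sub>F t in at_top. AE x in \<mu>. norm (?D t x) \<le> ?B" by simp
  qed auto
  moreover have "(\<integral>x. ?D t x \<partial>\<mu>) = (if t \<in> T then \<integral>\<omega>. deviation f t \<omega> \<partial>(\<mu> \<bind> P) else 0)" for t
    using integral_start[OF \<mu> deviation_measurable deviation_bound] by auto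
  ultimately show ?thesis by (simp add: tendsto_time_at_top_iff)
qed

section \<open>Convergence in probability, almost sure subsequences and mean measures\<close>

context
  fixes \<mu> :: "'a measure" assumes \<mu>: "\<mu> \<in> prob_measures"
begin

lemma deviation_integrable:
  assumes "t \<in> T" shows "integrable (\<mu> \<bind> P) (deviation f t)"
proof -
  interpret Q: prob_space "\<mu> \<bind> P" by (rule prob_space_start[OF \<mu>])
  show ?thesis
    using deviation_bound[OF assms] deviation_measurable[OF assms] sets_eq_imp_space_eq[OF sets_start[OF \<mu>]]
    by (intro Q.integrable_const_bound AE_I2) (auto simp: measurable_cong_sets[OF sets_start[OF \<mu>] refl])
qed

lemma time_average_start_measurable:
  "t \<in> T \<Longrightarrow> time_average T M f t \<in> borel_measurable (\<mu> \<bind> P)"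
  using time_average_measurable[OF _ lipschitz_borel_measurable[OF f]] by (simp add: measurable_cong_sets[OF sets_start[OF \<mu>] refl])

text \<open>Chebyshev, in the form of Markov's inequality for \<open>deviation\<close> at level
  \<open>e\<^sup>2\<close>.\<close>

lemma time_average_tendsto_in_prob:
  "tendsto_in_prob (\<mu> \<bind> P) (time_average T M f) (\<integral>y. f y \<partial>\<pi>) (time_at_top T)"
  unfolding tendsto_in_prob_def
proof (intro conjI allI impI)
  show "\<forall>\<^sub>F t in time_at_top T. time_average T M f t \<in> borel_measurable (\<mu> \<bind> P)"
    by (rule eventually_time_at_topI) (rule time_average_start_measurable)
  interpret Q: prob_space "\<mu> \<bind> P" by (rule prob_space_start[OF \<mu>])
  fix e :: real assume e: "e > 0"
  let ?m = "\<lambda>t. measure (\<mu> \<bind> P) {\<omega> \<in> space (\<mu> \<bind> P). \<bar>time_average T M f t \<omega> - (\<integral>y. f y \<partial>\<pi>)\<bar> > e}"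
  show "(?m \<longlongrightarrow> 0) (time_at_top T)"
  proof (rule tendsto_sandwich[where f="\<lambda>_. 0"])
    show "((\<lambda>t. (\<integral>\<omega>. deviation f t \<omega> \<partial>(\<mu> \<bind> P)) / e\<^sup>2) \<longlongrightarrow> 0) (time_at_top T)"
      using tendsto_divide_zero[OF deviation_tendsto[OF \<mu>], of "e\<^sup>2"] .
    show "\<forall>\<^sub>F t in time_at_top T. ?m t \<le> (\<integral>\<omega>. deviation f t \<omega> \<partial>(\<mu> \<bind> P)) / e\<^sup>2"
    proof (rule eventually_time_at_topI)
      fix t assume t: "t \<in> T" "0 < t"
      have "?m t \<le> measure (\<mu> \<bind> P) {\<omega> \<in> space (\<mu> \<bind> P). deviation f t \<omega> \<ge> e\<^sup>2}"
      proof (rule Q.finite_measure_mono)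
        show "{\<omega> \<in> space (\<mu> \<bind> P). \<bar>time_average T M f t \<omega> - (\<integral>y. f y \<partial>\<pi>)\<bar> > e}
            \<subseteq> {\<omega> \<in> space (\<mu> \<bind> P). deviation f t \<omega> \<ge> e\<^sup>2}"
          using e by (auto simp: deviation_def simp flip: abs_le_square_iff)
        show "{\<omega> \<in> space (\<mu> \<bind> P). deviation f t \<omega> \<ge> e\<^sup>2} \<in> Q.events"
          using borel_measurable_integrable[OF deviation_integrable[OF t(1)]] by measurable
      qed
      also have "\<dots> \<le> (\<integral>\<omega>. deviation f t \<omega> \<partial>(\<mu> \<bind> P)) / e\<^sup>2"
        by (rule integral_Markov_inequality_measure[OF deviation_integrable[OF t(1)] sets.empty_sets])
           (use e deviation_nonneg in auto)
      finally show "?m t \<le> (\<integral>\<omega>. deviation f t \<omega> \<partial>(\<mu> \<bind> P)) / e\<^sup>2" .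
    qed
  qed auto
qed

text \<open>The means of the nonnegative \<open>deviation\<close> tend to 0, which is convergence in
  L1, so a subsequence tends to 0 almost surely; square roots then lead back to the
  averages.\<close>

lemma time_average_AE_subseq:
  assumes tn: "range tn \<subseteq> T" "filterlim tn at_top sequentially"
  shows "\<exists>r :: nat \<Rightarrow> nat. strict_mono r \<and>
    (AE \<omega> in \<mu> \<bind> P. (\<lambda>k. time_average T M f (tn (r k)) \<omega>) \<longlonglongrightarrow> (\<integral>y. f y \<partial>\<pi>))"
proof -
  have "filterlim tn (time_at_top T) sequentially"
    unfolding time_at_top_def using tn by (simp add: filterlim_inf filterlim_principal range_subsetD)
  from filterlim_compose[OF deviation_tendsto[OF \<mu>] this]
  have "(\<lambda>n. \<integral>\<omega>. norm (deviation f (tn n) \<omega>) \<partial>(\<mu> \<bind> P)) \<longlonglongrightarrow> 0"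
    by (simp add: deviation_nonneg)
  from tendsto_L1_AE_subseq[OF deviation_integrable this] tn(1)
  obtain r :: "nat \<Rightarrow> nat" where r: "strict_mono r"
    and lim: "AE \<omega> in \<mu> \<bind> P. (\<lambda>n. deviation f (tn (r n)) \<omega>) \<longlonglongrightarrow> 0" by blast
  from lim have "AE \<omega> in \<mu> \<bind> P. (\<lambda>k. time_average T M f (tn (r k)) \<omega>) \<longlonglongrightarrow> (\<integral>y. f y \<partial>\<pi>)"
  proof eventually_elim
    case (elim \<omega>)
    from tendsto_real_sqrt[OF elim]
    have "(\<lambda>k. time_average T M f (tn (r k)) \<omega> - (\<integral>y. f y \<partial>\<pi>)) \<longlonglongrightarrow> 0"
      by (simp add: deviation_def tendsto_rabs_zero_iff)
    then show ?case by (rule LIM_zero_cancel)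
  qed
  with r show ?thesis by blast
qed

text \<open>The integral against the mean measure is the expectation of the time average, and the
  mean error is at most the root of the mean squared error.\<close>

lemma mean_measure_tendsto:
  "((\<lambda>t. \<integral>x. f x \<partial>mean_measure T P M \<mu> t) \<longlongrightarrow> (\<integral>y. f y \<partial>\<pi>)) (time_at_top T)"
proof -
  interpret Q: prob_space "\<mu> \<bind> P" by (rule prob_space_start[OF \<mu>])
  have "((\<lambda>t. (\<integral>x. f x \<partial>mean_measure T P M \<mu> t) - (\<integral>y. f y \<partial>\<pi>)) \<longlongrightarrow> 0) (time_at_top T)"
  proof (rule Lim_null_comparison)
    show "((\<lambda>t. sqrt (\<integral>\<omega>. deviation f t \<omega> \<partial>(\<mu> \<bind> P))) \<longlongrightarrow> 0) (time_at_top T)"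
      using tendsto_real_sqrt[OF deviation_tendsto[OF \<mu>]] by simp
    show "\<forall>\<^sub>F t in time_at_top T. norm ((\<integral>x. f x \<partial>mean_measure T P M \<mu> t) - (\<integral>y. f y \<partial>\<pi>))
        \<le> sqrt (\<integral>\<omega>. deviation f t \<omega> \<partial>(\<mu> \<bind> P))"
    proof (rule eventually_time_at_topI)
      fix t assume t: "t \<in> T" "0 < t"
      define X where "X \<omega> = time_average T M f t \<omega> - (\<integral>y. f y \<partial>\<pi>)" for \<omega>
      have X2: "integrable (\<mu> \<bind> P) (\<lambda>\<omega>. (X \<omega>)\<^sup>2)"
        using deviation_integrable[OF t(1)] by (simp add: X_def deviation_def[abs_def])
      have Xm: "X \<in> borel_measurable (\<mu> \<bind> P)"
        using time_average_start_measurable[OF t(1)] unfolding X_def by measurable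
      have X1: "integrable (\<mu> \<bind> P) X"
        by (rule Q.square_integrable_imp_integrable[OF Xm X2])
      \<comment> \<open>This is nonnegativity of the variance.\<close>
      have "(Q.expectation X)\<^sup>2 \<le> Q.expectation (\<lambda>\<omega>. (X \<omega>)\<^sup>2)"
        using Q.variance_eq[OF X1 X2] Q.variance_positive[of X] by simp
      moreover have "(\<integral>x. f x \<partial>mean_measure T P M \<mu> t) - (\<integral>y. f y \<partial>\<pi>) = Q.expectation X"
      proof -
        have "integrable (\<mu> \<bind> P) (\<lambda>\<omega>. X \<omega> + (\<integral>y. f y \<partial>\<pi>))" using X1 by simp
        then have "integrable (\<mu> \<bind> P) (time_average T M f t)" by (simp add: X_def)
        moreover have "(\<integral>x. f x \<partial>mean_measure T P M \<mu> t) = Q.expectation (time_average T M f t)"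
          by (rule integral_mean_measure[OF \<mu> t lipschitz_borel_measurable[OF f] lipschitz_bounded[OF dist_le_1 f]])
        ultimately show ?thesis by (simp add: X_def[abs_def] Q.prob_space)
      qed
      ultimately show "norm ((\<integral>x. f x \<partial>mean_measure T P M \<mu> t) - (\<integral>y. f y \<partial>\<pi>))
        \<le> sqrt (\<integral>\<omega>. deviation f t \<omega> \<partial>(\<mu> \<bind> P))"
        by (simp add: real_le_rsqrt X_def deviation_def)
    qed
  qed
  then show ?thesis by (rule LIM_zero_cancel)
qed

end
end

text \<open>A constant function has Lipschitz constant 0, while the estimates divide by
  \<open>L\<close>; the maximum with 1 is always positive.\<close>

lemma Lip_positive_constant:
  assumes "f \<in> Lip" obtains L where "L-lipschitz_on UNIV f" "L > 0"
proof -
  obtain K where "K-lipschitz_on UNIV f" using assms by (auto simp: Lip_def)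
  then have "(max K 1)-lipschitz_on UNIV f" by (rule lipschitz_on_mono) auto
  then show thesis by (rule that) simp
qed

lemma mean_measure_tendsto_weakly:
  assumes \<mu>: "\<mu> \<in> prob_measures"
  shows "tendsto_weakly (mean_measure T P M \<mu>) \<pi> (time_at_top T)"
proof (rule tendsto_weakly_lipschitzI[OF _ \<pi>])
  show "\<forall>\<^sub>F t in time_at_top T. mean_measure T P M \<mu> t \<in> prob_measures"
    by (rule eventually_time_at_topI) (rule mean_measure_prob_measures[OF \<mu>])
  fix f :: "'a \<Rightarrow> real" and K assume "K-lipschitz_on UNIV f"
  then have "f \<in> Lip" by (auto simp: Lip_def)
  then obtain L where L: "L-lipschitz_on UNIV f" "L > 0" by (rule Lip_positive_constant)
  show "((\<lambda>t. \<integral>x. f x \<partial>mean_measure T P M \<mu> t) \<longlongrightarrow> (\<integral>y. f y \<partial>\<pi>)) (time_at_top T)"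
    by (rule mean_measure_tendsto[OF L \<mu>])
qed

end

theorem corollary1p3:
  fixes T :: "real set"
    and \<F> :: "'w measure"
    and P :: "'a::polish_space \<Rightarrow> 'w measure"
    and Ft :: "real \<Rightarrow> 'w measure"
    and \<theta> :: "real \<Rightarrow> 'w \<Rightarrow> 'w"
    and M :: "real \<Rightarrow> 'w \<Rightarrow> 'a"
    and \<pi> :: "'a measure"
  assumes dist_le_1: "\<And>x y :: 'a. dist x y \<le> 1"
    and markov_process: "markov_process T \<F> P Ft \<theta> M"
    and \<pi>: "\<pi> \<in> prob_measures"
    and ergodic: "\<And>x. ((\<lambda>t. SUP s\<in>T. \<integral>y. wasserstein (transition P M t y) \<pi> \<partial>transition P M s x)
                    \<longlongrightarrow> 0) (time_at_top T)"
  shows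
    "(\<forall>f\<in>Lip. \<forall>\<mu>\<in>prob_measures.
        tendsto_in_prob (\<mu> \<bind> P) (time_average T M f) (\<integral>y. f y \<partial>\<pi>) (time_at_top T))
   \<and> (\<forall>f\<in>Lip. \<forall>\<mu>\<in>prob_measures. \<forall>tn :: nat \<Rightarrow> real.
        range tn \<subseteq> T \<longrightarrow> incseq tn \<longrightarrow> filterlim tn at_top sequentially \<longrightarrow>
        (\<exists>r :: nat \<Rightarrow> nat. strict_mono r \<and>
           (AE \<omega> in \<mu> \<bind> P. (\<lambda>k. time_average T M f (tn (r k)) \<omega>) \<longlonglongrightarrow> (\<integral>y. f y \<partial>\<pi>))))
   \<and> (\<forall>\<mu>\<in>prob_measures.
        tendsto_weakly (mean_measure T P M \<mu>) \<pi> (time_at_top T))"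
proof -
  interpret markov_process T \<F> P Ft \<theta> M by (rule markov_process)
  interpret ergodic_markov_process T \<F> P Ft \<theta> M \<pi>
    by unfold_locales (rule dist_le_1 \<pi> ergodic)+
  show ?thesis
    by (intro conjI ballI allI impI)
      (blast elim: Lip_positive_constant intro: time_average_tendsto_in_prob
        time_average_AE_subseq mean_measure_tendsto_weakly)+
qed

end
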